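(* Let $X$ be either a longpipe or a sealed longpipe. If $\mathsf{EC}(X,\mathbb{R})$ holds, then $a\mathsf{S}(X,\mathbb{R})$ does not hold.
   Context: All spaces are Hausdorff and maps continuous. A space $X$ is of Type I if $X=\bigcup_{\alpha<\omega_1}X_\alpha$ with $X_\alpha$ open, $\overline{X_\alpha}\subset X_\beta$ for $\alpha<\beta$, $\overline{X_\alpha}$ Lindelöf, $X\ne X_\alpha$ for all $\alpha$; the cover is canonical if moreover $X_\beta=\bigcup_{\alpha<\beta}X_\alpha$ for limit $\beta$. A space is $\omega$-bounded if every countable subset has compact closure. A longpipe is an $\omega$-bounded (hence Type I) surface (2-manifold, possibly with boundary) $S=\bigcup_{\alpha<\omega_1}S_\alpha$ with canonical cover such that each $S_{\alpha+1}$ is homeomorphic to $\mathbb{S}^1\times[0,1)$ and the topological boundary of $S_{\alpha+1}$ in $S_\beta$ is homeomorphic to the circle for every $\alpha$ and every $\beta\ge\alpha+2$; its manifold boundary is a circle. A sealed longpipe is obtained from a longpipe by gluing a closed 2-disc along its boundary circle to this boundary circle. For a non-Lindelöf space $X$ and a space $Y$: $\mathsf{EC}(X,Y)$ means that for every continuous $f:X\to Y$ there is a Lindelöf $Z\subset X$ with $f(X\setminus Z)$ a singleton; $a\mathsf{S}(X,Y)$ means that for every continuous $f:X\to Y$ there are a Lindelöf $Z\subset X$ and a continuous $r:X\to Z$ with $f\circ r=f$. *)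

theory Defs
  imports "HOL-Analysis.Analysis"
begin

definition omega1_order :: "real rel \<Rightarrow> bool" where
  "omega1_order W \<longleftrightarrow> Well_order W \<and> uncountable (Field W) \<and>
     (\<forall>a\<in>Field W. countable (underS W a))"

definition is_succ :: "real rel \<Rightarrow> real \<Rightarrow> real \<Rightarrow> bool" where
  "is_succ W a b \<longleftrightarrow> (a, b) \<in> W \<and> a \<noteq> b \<and>
     (\<forall>c. (a, c) \<in> W \<and> a \<noteq> c \<longrightarrow> (b, c) \<in> W)"

definition is_limit :: "real rel \<Rightarrow> real \<Rightarrow> bool" where
  "is_limit W b \<longleftrightarrow> b \<in> Field W \<and> (\<exists>a. (a, b) \<in> W \<and> a \<noteq> b) \<and>
     \<not> (\<exists>a. is_succ W a b)"

definition typeI_cover :: "'a topology \<Rightarrow> real rel \<Rightarrow> (real \<Rightarrow> 'a set) \<Rightarrow> bool" where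
  "typeI_cover X W Xs \<longleftrightarrow> omega1_order W \<and>
     (\<forall>a\<in>Field W. openin X (Xs a)) \<and>
     topspace X = (\<Union>a\<in>Field W. Xs a) \<and>
     (\<forall>a b. (a, b) \<in> W \<and> a \<noteq> b \<longrightarrow> X closure_of (Xs a) \<subseteq> Xs b) \<and>
     (\<forall>a\<in>Field W. Lindelof_space (subtopology X (X closure_of (Xs a)))) \<and>
     (\<forall>a\<in>Field W. Xs a \<noteq> topspace X)"

definition canonical_typeI_cover :: "'a topology \<Rightarrow> real rel \<Rightarrow> (real \<Rightarrow> 'a set) \<Rightarrow> bool" where
  "canonical_typeI_cover X W Xs \<longleftrightarrow> typeI_cover X W Xs \<and>
     (\<forall>b. is_limit W b \<longrightarrow> Xs b = (\<Union>a\<in>{a. (a, b) \<in> W \<and> a \<noteq> b}. Xs a))"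

definition omega_bounded :: "'a topology \<Rightarrow> bool" where
  "omega_bounded X \<longleftrightarrow>
     (\<forall>S. S \<subseteq> topspace X \<and> countable S \<longrightarrow> compactin X (X closure_of S))"

definition half_plane :: "(real \<times> real) set" where
  "half_plane = {p. snd p \<ge> 0}"

definition surface :: "'a topology \<Rightarrow> bool" where
  "surface X \<longleftrightarrow> Hausdorff_space X \<and>
     (\<forall>x\<in>topspace X. \<exists>U V. openin X U \<and> x \<in> U \<and>
        openin (top_of_set half_plane) V \<and>
        subtopology X U homeomorphic_space top_of_set V)"

definition manifold_boundary :: "'a topology \<Rightarrow> 'a set" where
  "manifold_boundary X = {x \<in> topspace X. \<exists>U V h. openin X U \<and> x \<in> U \<and>
        openin (top_of_set half_plane) V \<and>
        homeomorphic_map (subtopology X U) (top_of_set V) h \<and> snd (h x) = 0}"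

definition circle :: "(real \<times> real) topology" where
  "circle = top_of_set (sphere (0::real \<times> real) 1)"

definition half_open_annulus :: "((real \<times> real) \<times> real) topology" where
  "half_open_annulus = prod_topology (top_of_set (sphere (0::real \<times> real) 1))
                                      (top_of_set {0..<1})"

definition longpipe :: "'a topology \<Rightarrow> bool" where
  "longpipe X \<longleftrightarrow> Hausdorff_space X \<and> surface X \<and> omega_bounded X \<and>
     (\<exists>W Xs. canonical_typeI_cover X W Xs \<and>
        (\<forall>a b. is_succ W a b \<longrightarrow> subtopology X (Xs b) homeomorphic_space half_open_annulus) \<and>
        (\<forall>a s t c. is_succ W a s \<and> is_succ W s t \<and> (t, c) \<in> W \<longrightarrow>
           subtopology X ((subtopology X (Xs c)) frontier_of (Xs s)) homeomorphic_space circle)) \<and>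
     subtopology X (manifold_boundary X) homeomorphic_space circle"

text \<open>A sealed longpipe: the space is the union of two closed subspaces L (a longpipe)
and D (a closed 2-disc) meeting exactly in the boundary circle of L, which corresponds
to the boundary circle of the disc. Since L and D form a finite closed cover, the
topology of the space is the one of the adjunction space.\<close>
definition sealed_longpipe :: "'a topology \<Rightarrow> bool" where
  "sealed_longpipe X \<longleftrightarrow> Hausdorff_space X \<and>
     (\<exists>L D h. closedin X L \<and> closedin X D \<and> L \<union> D = topspace X \<and>
        longpipe (subtopology X L) \<and>
        L \<inter> D = manifold_boundary (subtopology X L) \<and>
        homeomorphic_map (subtopology X D) (top_of_set (cball (0::real \<times> real) 1)) h \<and>
        h ` (L \<inter> D) = sphere 0 1)"

definition EC :: "'a topology \<Rightarrow> 'b topology \<Rightarrow> bool" where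
  "EC X Y \<longleftrightarrow> (\<forall>f. continuous_map X Y f \<longrightarrow>
     (\<exists>Z. Z \<subseteq> topspace X \<and> Lindelof_space (subtopology X Z) \<and>
          (\<exists>c. f ` (topspace X - Z) = {c})))"

definition aS :: "'a topology \<Rightarrow> 'b topology \<Rightarrow> bool" where
  "aS X Y \<longleftrightarrow> (\<forall>f. continuous_map X Y f \<longrightarrow>
     (\<exists>Z r. Z \<subseteq> topspace X \<and> Lindelof_space (subtopology X Z) \<and>
          continuous_map X (subtopology X Z) r \<and>
          (\<forall>x\<in>topspace X. f (r x) = f x)))"

end

theory Submission
  imports Defs
begin

text \<open>
On a chart \<open>S\<^sup>1 \<times> [0,1)\<close> of the pipe, drawn as a plane annulus, place six unit discs
in a ring around the core, consecutive ones tangent, and let \<open>f\<close> be the sum of conical bumps over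
these discs with peak values \<open>3, -1, 2, -3, 1, -2\<close>, extended by zero; in the sealed case \<open>f\<close> also
gets a well of depth 10 over the sealing disc, whose bottom is attained at the centre only. If
\<open>f \<circ> r = f\<close>, then \<open>r\<close> sends each disc into a cell where \<open>f\<close> has the same sign and at least the
same height, and cells of tangent discs must touch; this forces \<open>r\<close> to map every disc into itself.
As discs are convex, \<open>r\<close> is homotopic inside the chart to the identity on a circle \<open>J\<close>
covered by the discs.

If the image of \<open>r\<close> lies in a Lindelof set, then \<open>r\<close> followed by a larger chart has complex values
that vanish nowhere on the pipe (\<open>r\<close> avoids the centre of the sealing disc, where \<open>f = -10\<close>).
By \<open>EC\<close> its coordinates are eventually constant, and pushing \<open>J\<close> to infinity along the pipe shows
that \<open>r\<close> restricted to \<open>J\<close> is null-homotopic in the punctured plane. But \<open>J\<close> itself is homotopic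
to the boundary circle, which by invariance of domain is embedded in the boundary circle of the
larger chart, and an injective map between circles is not null-homotopic.
\<close>

section \<open>Bounds and successors in the index order of a Type I cover\<close>

text \<open>Countably many countable initial segments cannot exhaust an uncountable field, and by
  linearity any index left over lies strictly above all of \<open>I\<close>.\<close>

lemma omega1_order_bounded:
  assumes "omega1_order W" and "countable I" and "I \<subseteq> Field W"
  obtains b where "b \<in> Field W" and "\<And>a. a \<in> I \<Longrightarrow> (a, b) \<in> W \<and> a \<noteq> b"
proof -
  have lin: "Linear_order W" and unc: "uncountable (Field W)"
    and cnt: "\<And>a. a \<in> Field W \<Longrightarrow> countable (underS W a)"
    using assms(1) by (auto simp: omega1_order_def well_order_on_def)
  have "countable ((\<Union>a\<in>I. underS W a) \<union> I)"
    using assms(2,3) cnt by (auto intro!: countable_UN)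
  then have "\<not> Field W \<subseteq> (\<Union>a\<in>I. underS W a) \<union> I"
    using unc countable_subset by blast
  then obtain b where b: "b \<in> Field W" "b \<notin> (\<Union>a\<in>I. underS W a)" "b \<notin> I"
    by blast
  have "(a, b) \<in> W \<and> a \<noteq> b" if "a \<in> I" for a
  proof -
    have "a \<in> Field W" "a \<noteq> b" "\<not> ((b, a) \<in> W)"
      using that b assms(3) by (auto simp: underS_def)
    then show ?thesis
      using lin b(1) by (auto simp: linear_order_on_def total_on_def)
  qed
  with b(1) show thesis using that by blast
qed

text \<open>The successor is the least strict upper bound, which exists by well-foundedness because
  strict upper bounds exist at all.\<close>

lemma omega1_order_succ:
  assumes "omega1_order W" and "a \<in> Field W"
  obtains b where "is_succ W a b"
proof -
  have lin: "Linear_order W" and wf: "wf (W - Id)"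
    using assms(1) by (auto simp: omega1_order_def well_order_on_def)
  define S where "S = {c. (a, c) \<in> W \<and> a \<noteq> c}"
  obtain c where "c \<in> S"
    using omega1_order_bounded[OF assms(1), of "{a}"] assms(2) unfolding S_def by auto
  then obtain b where b: "b \<in> S" and min: "\<And>y. (y, b) \<in> W - Id \<Longrightarrow> y \<notin> S"
    using wfE_min[OF wf] by metis
  have "(b, c) \<in> W" if "c \<in> S" for c
  proof -
    have "b \<in> Field W" "c \<in> Field W"
      using b that by (auto simp: S_def Field_def)
    then show ?thesis
      using lin min[of c] that
      by (cases "b = c") (auto simp: linear_order_on_def partial_order_on_def preorder_on_def
          total_on_def refl_on_def)
  qed
  then have "is_succ W a b"
    using b by (auto simp: is_succ_def S_def)
  then show thesis using that by blast
qed

section \<open>Plane annuli as charts of a longpipe\<close>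

text \<open>A plane model of the half-open annulus, so that discs, segments and logarithms are at
  hand. It contains its inner circle but not its outer one; the discs placed later have radii
  between 1 and 3, clear of both ends.\<close>

definition ann :: "complex set" where
  "ann = {z. 1/2 \<le> norm z \<and> norm z < 4}"

text \<open>Polar coordinates: the parameter in \<open>[0,1)\<close> is rescaled to a radius running
  from 1/2 up to, but excluding, 4.\<close>

lemma half_open_annulus_homeomorphic_ann:
  "half_open_annulus homeomorphic_space top_of_set ann"
proof -
  define F where "F = (\<lambda>p :: (real \<times> real) \<times> real. complex_of_real (1/2 + 7/2 * snd p) * Complex (fst (fst p)) (snd (fst p)))"
  define G where "G = (\<lambda>z. ((Re z / norm z, Im z / norm z), (norm z - 1/2) * 2/7))"
  have N: "norm (F p) = 1/2 + 7/2 * snd p" if "fst p \<in> sphere 0 1" "0 \<le> snd p" for p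
  proof -
    have "norm (Complex (fst (fst p)) (snd (fst p))) = 1"
      using that by (simp add: complex_norm norm_prod_def)
    then show ?thesis
      using that(2) unfolding F_def norm_mult by (simp only: norm_of_real) simp
  qed
  have "homeomorphic_maps half_open_annulus (top_of_set ann) F G"
    unfolding homeomorphic_maps_def
  proof (intro conjI ballI)
    have "continuous_on (sphere 0 1 \<times> {0..<1}) F"
      unfolding F_def Complex_eq by (intro continuous_intros)
    moreover have "F ` (sphere 0 1 \<times> {0..<1}) \<subseteq> ann"
      using N by (fastforce simp: ann_def)
    ultimately show "continuous_map half_open_annulus (top_of_set ann) F"
      by (auto simp: half_open_annulus_def subtopology_Times[symmetric] euclidean_product_topology)
  next
    have "continuous_on ann G"
      unfolding G_def by (intro continuous_intros) (auto simp: ann_def)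
    moreover have "G ` ann \<subseteq> sphere 0 1 \<times> {0..<1}"
    proof (rule image_subsetI)
      fix z assume z: "z \<in> ann"
      then have "norm z \<noteq> 0" by (auto simp: ann_def)
      moreover have "(Re z)\<^sup>2 + (Im z)\<^sup>2 = (norm z)\<^sup>2"
        by (simp add: cmod_power2)
      ultimately have "(Re z / norm z)\<^sup>2 + (Im z / norm z)\<^sup>2 = 1"
        by (simp add: power_divide add_divide_distrib[symmetric])
      then have "norm (fst (G z)) = 1"
        by (simp add: G_def norm_prod_def power_divide)
      then show "G z \<in> sphere 0 1 \<times> {0..<1}"
        using z by (auto simp: G_def ann_def mem_Times_iff)
    qed
    ultimately show "continuous_map (top_of_set ann) half_open_annulus G"
      by (auto simp: half_open_annulus_def subtopology_Times[symmetric] euclidean_product_topology)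
  next
    fix p assume "p \<in> topspace half_open_annulus"
    then have p: "fst p \<in> sphere 0 1" "0 \<le> snd p"
      by (auto simp: half_open_annulus_def)
    show "G (F p) = p"
      using N[OF p] p(2) unfolding G_def
      by (auto simp: F_def prod_eq_iff Complex_eq)
  next
    fix z assume "z \<in> topspace (top_of_set ann)"
    then have "norm z \<noteq> 0" by (auto simp: ann_def)
    then show "F (G z) = z"
      by (auto simp: F_def G_def complex_eq_iff field_simps)
  qed
  then show ?thesis
    using homeomorphic_space_def by blast
qed

text \<open>Separability passes to continuous images. Combined with omega-boundedness it encloses a
  whole chart in a compact set.\<close>

lemma countable_dense_image:
  fixes A :: "'b::euclidean_space set"
  assumes "continuous_map (top_of_set A) (subtopology P E) e" and "e ` A = E"
  obtains S where "countable S" and "S \<subseteq> E" and "E \<subseteq> P closure_of S"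
proof -
  obtain T where T: "countable T" "T \<subseteq> A" "A \<subseteq> closure T"
    using separable by blast
  have c: "continuous_map (top_of_set A) P e"
    using assms(1) by (simp add: continuous_map_in_subtopology)
  have "e ` (top_of_set A closure_of T) \<subseteq> P closure_of (e ` T)"
    using c continuous_map_image_closure_subset by blast
  moreover have "top_of_set A closure_of T = A"
    using T by (auto simp: closure_of_subtopology Int_absorb1)
  ultimately show thesis
    using that[of "e ` T"] T assms(2) by (metis countable_image image_mono)
qed

definition annular_chart :: "'a topology \<Rightarrow> 'a set \<Rightarrow> (complex \<Rightarrow> 'a) \<Rightarrow> ('a \<Rightarrow> complex) \<Rightarrow> bool" where
  "annular_chart P E e g \<longleftrightarrow> openin P E \<and> homeomorphic_maps (top_of_set ann) (subtopology P E) e g"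

lemma annular_chartD:
  assumes "annular_chart P E e g"
  shows "openin P E" and "E \<subseteq> topspace P"
    and "continuous_map (top_of_set ann) P e" and "e ` ann = E"
    and "continuous_map (subtopology P E) (top_of_set ann) g" and "g ` E \<subseteq> ann"
    and "\<And>z. z \<in> ann \<Longrightarrow> g (e z) = z" and "\<And>x. x \<in> E \<Longrightarrow> e (g x) = x"
proof -
  show o: "openin P E" and E: "E \<subseteq> topspace P"
    using assms openin_subset by (auto simp: annular_chart_def)
  have h: "homeomorphic_maps (top_of_set ann) (subtopology P E) e g"
    using assms by (simp add: annular_chart_def)
  then have c: "continuous_map (top_of_set ann) (subtopology P E) e"
    and c': "continuous_map (subtopology P E) (top_of_set ann) g"
    and l: "\<And>z. z \<in> ann \<Longrightarrow> g (e z) = z" and r: "\<And>x. x \<in> E \<Longrightarrow> e (g x) = x"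
    using E by (auto simp: homeomorphic_maps_def)
  show "continuous_map (top_of_set ann) P e"
    using c by (simp add: continuous_map_in_subtopology)
  show "continuous_map (subtopology P E) (top_of_set ann) g" by fact
  show i: "g ` E \<subseteq> ann"
    using c' E by (auto simp: continuous_map_def Pi_iff)
  show "e ` ann = E"
    using c E r i by (force simp: continuous_map_def Pi_iff image_iff)
  show "\<And>z. z \<in> ann \<Longrightarrow> g (e z) = z" "\<And>x. x \<in> E \<Longrightarrow> e (g x) = x"
    by fact+
qed

text \<open>The compact \<open>K\<close> makes nesting possible: it is Lindelof again, so a further
  chart can be chosen around it, inside which \<open>E\<close> stays away from the open end.\<close>

definition annularly_exhausted :: "'a topology \<Rightarrow> bool" where
  "annularly_exhausted P \<longleftrightarrow>
     (\<forall>Q. Q \<subseteq> topspace P \<and> Lindelof_space (subtopology P Q) \<longrightarrow>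
        (\<exists>E e g K. Q \<subseteq> E \<and> E \<subseteq> K \<and> compactin P K \<and> annular_chart P E e g))"

text \<open>A Lindelof set is covered by countably many stages of the cover, hence lies in a single
  later stage of successor index, which is an annulus. A countable dense subset of that stage has
  compact closure by omega-boundedness.\<close>

lemma longpipe_annularly_exhausted:
  assumes "longpipe P"
  shows "annularly_exhausted P"
  unfolding annularly_exhausted_def
proof (intro allI impI, elim conjE)
  fix Q assume Q: "Q \<subseteq> topspace P" "Lindelof_space (subtopology P Q)"
  obtain W Xs where cov: "typeI_cover P W Xs"
    and an: "\<And>a b. is_succ W a b \<Longrightarrow> subtopology P (Xs b) homeomorphic_space half_open_annulus"
    using assms by (auto simp: longpipe_def canonical_typeI_cover_def)
  have W: "omega1_order W" and op: "\<And>a. a \<in> Field W \<Longrightarrow> openin P (Xs a)"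
    and un: "topspace P = (\<Union>a\<in>Field W. Xs a)"
    and mono: "\<And>a b. (a, b) \<in> W \<Longrightarrow> a \<noteq> b \<Longrightarrow> Xs a \<subseteq> Xs b"
  proof -
    show "omega1_order W" "\<And>a. a \<in> Field W \<Longrightarrow> openin P (Xs a)" "topspace P = (\<Union>a\<in>Field W. Xs a)"
      using cov by (auto simp: typeI_cover_def)
    show "Xs a \<subseteq> Xs b" if "(a, b) \<in> W" "a \<noteq> b" for a b
    proof -
      have "openin P (Xs a)" "P closure_of (Xs a) \<subseteq> Xs b"
        using cov that by (auto simp: typeI_cover_def Field_def)
      then show ?thesis
        by (meson closure_of_subset dual_order.trans openin_subset)
    qed
  qed
  have "\<exists>\<V>. countable \<V> \<and> \<V> \<subseteq> Xs ` Field W \<and> Q \<subseteq> \<Union>\<V>"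
    using Q un op Lindelof_space_subtopology_subset[OF Q(1)] by (metis (mono_tags, lifting) imageE)
  then obtain I where I: "countable I" "I \<subseteq> Field W" "Q \<subseteq> (\<Union>a\<in>I. Xs a)"
    by (metis countable_subset_image)
  obtain b where b: "b \<in> Field W" "\<And>a. a \<in> I \<Longrightarrow> (a, b) \<in> W \<and> a \<noteq> b"
    using omega1_order_bounded[OF W I(1,2)] by blast
  obtain c where c: "is_succ W b c"
    using omega1_order_succ[OF W b(1)] by blast
  then have bc: "(b, c) \<in> W" "b \<noteq> c"
    by (auto simp: is_succ_def)
  then have oc: "openin P (Xs c)"
    using op by (auto simp: Field_def)
  have "Q \<subseteq> Xs c"
    using I(3) b(2) mono bc by blast
  moreover have "top_of_set ann homeomorphic_space subtopology P (Xs c)"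
    using an[OF c] half_open_annulus_homeomorphic_ann
    by (meson homeomorphic_space_sym homeomorphic_space_trans)
  then obtain e g where eg: "annular_chart P (Xs c) e g"
    using oc by (auto simp: homeomorphic_space_def annular_chart_def)
  moreover obtain S where S: "countable S" "S \<subseteq> Xs c" "Xs c \<subseteq> P closure_of S"
    using countable_dense_image[of ann P "Xs c" e] annular_chartD[OF eg] eg
    by (metis annular_chart_def homeomorphic_maps_def)
  moreover have "S \<subseteq> topspace P"
    using S(2) openin_subset[OF oc] by blast
  then have "compactin P (P closure_of S)"
    using assms S(1) by (simp add: longpipe_def omega_bounded_def)
  ultimately show "\<exists>E e g K. Q \<subseteq> E \<and> E \<subseteq> K \<and> compactin P K \<and> annular_chart P E e g"
    by blast
qed

section \<open>Invariance of domain at the inner edge of a chart\<close>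

lemma open_ann_interior: "open (ann \<inter> {z. 1/2 < norm z})"
proof -
  have "ann \<inter> {z. 1/2 < norm z} = {z. 1/2 < norm z} \<inter> {z. norm z < 4}"
    by (auto simp: ann_def)
  moreover have "open {z::complex. 1/2 < norm z}" "open {z::complex. norm z < 4}"
    by (intro open_Collect_less continuous_intros)+
  ultimately show ?thesis
    by auto
qed

text \<open>A ball about \<open>z\<close> contains a point on the ray through \<open>z\<close>
  nearer to the origin, and such a point has left \<open>ann\<close>.\<close>

lemma not_open_inner_boundary:
  assumes "z \<in> S" and "S \<subseteq> ann" and "norm z = 1/2"
  shows "\<not> open S"
proof
  assume "open S"
  then obtain d where d: "d > 0" "ball z d \<subseteq> S"
    using assms(1) openE by blast
  define w where "w = (1 - min 1 d) *\<^sub>R z"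
  have "z - w = min 1 d *\<^sub>R z"
    by (simp add: w_def algebra_simps)
  then have "dist z w = min 1 d * (1/2)"
    using d(1) assms(3) by (simp add: dist_norm)
  then have "dist z w < d"
    using d(1) by linarith
  then have "1/2 \<le> norm w"
    using d(2) assms(2) by (auto simp: ann_def)
  moreover have "norm w = (1 - min 1 d) * (1/2)"
    using assms(3) by (simp add: w_def)
  ultimately show False
    using d(1) by (simp add: min_def split: if_splits)
qed

text \<open>Otherwise the transition map from the larger chart to the smaller would be defined on an
  open plane set around \<open>g' (e z)\<close>. By invariance of domain its image would be an open
  set inside \<open>ann\<close> containing the edge point \<open>z\<close>.\<close>

lemma annular_chart_inner_boundary:
  assumes c: "annular_chart P E e g" and c': "annular_chart P E' e' g'"
    and "E \<subseteq> E'" and z: "z \<in> ann" "norm z = 1/2"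
  shows "norm (g' (e z)) = 1/2"
proof (rule ccontr)
  note C = annular_chartD[OF c] and C' = annular_chartD[OF c']
  have ez: "e z \<in> E" "e z \<in> E'"
    using C(4) z assms(3) by auto
  assume "norm (g' (e z)) \<noteq> 1/2"
  then have gt: "1/2 < norm (g' (e z))"
    using C'(6) ez by (force simp: ann_def)
  define S where "S = {w \<in> ann \<inter> {w. 1/2 < norm w}. e' w \<in> E}"
  have "openin (top_of_set ann) {w \<in> ann. e' w \<in> E}"
    using openin_continuous_map_preimage[OF C'(3) C(1)] by simp
  then obtain T where T: "open T" "{w \<in> ann. e' w \<in> E} = ann \<inter> T"
    by (auto simp: openin_open)
  have "S = (ann \<inter> {w. 1/2 < norm w}) \<inter> T"
    using T(2) by (auto simp: S_def)
  then have "open S"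
    using T(1) open_ann_interior by auto
  moreover have "continuous_on S (g \<circ> e')"
  proof -
    have "continuous_map (top_of_set S) (subtopology P E) e'"
      using C'(3) by (auto simp: continuous_map_in_subtopology S_def
          intro: continuous_map_from_subtopology_mono)
    then have "continuous_map (top_of_set S) (top_of_set ann) (g \<circ> e')"
      using C(5) continuous_map_compose by blast
    then show ?thesis
      by (simp add: continuous_map_in_subtopology)
  qed
  moreover have "inj_on (g \<circ> e') S"
    by (rule inj_on_inverseI[of _ "g' \<circ> e"]) (use C C' in \<open>auto simp: S_def\<close>)
  ultimately have "open ((g \<circ> e') ` S)"
    by (intro invariance_of_domain)
  moreover have "g' (e z) \<in> S"
    using gt C'(6,8) ez by (auto simp: S_def)
  then have "z \<in> (g \<circ> e') ` S"
    using ez C'(8) C(7) z by (force simp: image_iff)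
  moreover have "(g \<circ> e') ` S \<subseteq> ann"
    using C(6) by (auto simp: S_def)
  ultimately show False
    using not_open_inner_boundary[of z "(g \<circ> e') ` S"] z(2) by blast
qed

text \<open>Composing with a boundary chart \<open>h\<close> gives an injective map of an open plane
  set, whose image is open by invariance of domain. It would contain points just below
  \<open>h (e z)\<close>, outside the half plane.\<close>

lemma annular_chart_interior_not_boundary:
  assumes c: "annular_chart P E e g" and z: "z \<in> ann" "1/2 < norm z"
  shows "e z \<notin> manifold_boundary P"
proof
  note C = annular_chartD[OF c]
  assume "e z \<in> manifold_boundary P"
  then obtain U V h where U: "openin P U" "e z \<in> U"
    and V: "openin (top_of_set half_plane) V"
    and h: "homeomorphic_map (subtopology P U) (top_of_set V) h" "snd (h (e z)) = 0"
    by (auto simp: manifold_boundary_def)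
  have UP: "topspace (subtopology P U) = U"
    using U(1) openin_subset by (auto simp: topspace_subtopology)
  define S where "S = {w \<in> ann \<inter> {w. 1/2 < norm w}. e w \<in> U}"
  have "openin (top_of_set ann) {w \<in> ann. e w \<in> U}"
    using openin_continuous_map_preimage[OF C(3) U(1)] by simp
  then obtain T where T: "open T" "{w \<in> ann. e w \<in> U} = ann \<inter> T"
    by (auto simp: openin_open)
  have "S = (ann \<inter> {w. 1/2 < norm w}) \<inter> T"
    using T(2) by (auto simp: S_def)
  then have "open S"
    using T(1) open_ann_interior by auto
  moreover have "continuous_on S (h \<circ> e)"
  proof -
    have "continuous_map (top_of_set S) (subtopology P U) e"
      using C(3) by (auto simp: continuous_map_in_subtopology S_def
          intro: continuous_map_from_subtopology_mono)
    then have "continuous_map (top_of_set S) (top_of_set V) (h \<circ> e)"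
      using homeomorphic_imp_continuous_map[OF h(1)] continuous_map_compose by blast
    then show ?thesis
      by (simp add: continuous_map_in_subtopology)
  qed
  moreover have "inj_on (h \<circ> e) S"
  proof (rule comp_inj_on)
    show "inj_on e S"
      by (rule inj_on_inverseI[of _ g]) (use C in \<open>auto simp: S_def\<close>)
    show "inj_on h (e ` S)"
      using homeomorphic_imp_injective_map[OF h(1)] UP by (auto simp: S_def intro: inj_on_subset)
  qed
  ultimately have "open ((h \<circ> e) ` S)"
    by (intro invariance_of_domain_gen) auto
  moreover have "h (e z) \<in> (h \<circ> e) ` S"
    using z U(2) by (auto simp: S_def)
  ultimately obtain d where d: "d > 0" "ball (h (e z)) d \<subseteq> (h \<circ> e) ` S"
    using openE by blast
  have "h ` U \<subseteq> half_plane"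
    using homeomorphic_imp_surjective_map[OF h(1)] UP openin_imp_subset[OF V] by simp
  then have hp: "(h \<circ> e) ` S \<subseteq> half_plane"
    by (auto simp: S_def)
  have "h (e z) - (0, d/2) \<in> ball (h (e z)) d"
    using d(1) by (simp add: dist_norm norm_prod_def)
  then have "h (e z) - (0, d/2) \<in> half_plane"
    using d(2) hp by blast
  then show False
    using h(2) d(1) by (simp add: half_plane_def)
qed

section \<open>Essential maps between circles\<close>

text \<open>A null-homotopic map has a continuous logarithm \<open>g\<close>, whose real part is
  constant because the norm of \<open>f\<close> is. The odd function \<open>k\<close> must vanish
  somewhere on the connected circle, so two antipodal points share a logarithm and hence a
  value.\<close>

lemma injective_circle_not_nullhomotopic:
  fixes f :: "complex \<Rightarrow> complex"
  assumes "s > 0" and "c > 0" and inj: "inj_on f (sphere 0 s)"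
    and norm: "\<And>z. z \<in> sphere 0 s \<Longrightarrow> norm (f z) = c"
  shows "\<not> homotopic_with_canon (\<lambda>_. True) (sphere 0 s) (-{0}) f (\<lambda>_. a)"
proof
  assume "homotopic_with_canon (\<lambda>_. True) (sphere 0 s) (-{0}) f (\<lambda>_. a)"
  then obtain g where g: "continuous_on (sphere 0 s) g" "\<And>x. x \<in> sphere 0 s \<Longrightarrow> f x = exp (g x)"
    using inessential_eq_continuous_logarithm[of "sphere 0 s" f] by blast
  have Re: "Re (g x) = ln c" if "x \<in> sphere 0 s" for x
    using g(2)[OF that] norm[OF that] assms(2) by (metis ln_exp norm_exp_eq_Re)
  define k where "k x = Im (g x) - Im (g (- x))" for x
  have "continuous_on (sphere 0 s) k"
    unfolding k_def
    by (intro continuous_intros g(1) continuous_on_compose2[OF g(1)]) auto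
  moreover have "connected (sphere (0::complex) s)"
    by (simp add: connected_sphere)
  ultimately have conn: "connected (k ` sphere 0 s)"
    using connected_continuous_image by blast
  have "of_real s \<in> sphere (0::complex) s" "- of_real s \<in> sphere (0::complex) s"
    using assms(1) by auto
  then have "k (of_real s) \<in> k ` sphere 0 s" "k (- of_real s) \<in> k ` sphere 0 s"
    by auto
  moreover have "k (- of_real s) = - k (of_real s)"
    by (simp add: k_def)
  ultimately have "0 \<in> k ` sphere 0 s"
    using conn unfolding connected_iff_interval
    by (metis linorder_linear neg_0_le_iff_le neg_le_0_iff_le)
  then obtain x where x: "x \<in> sphere 0 s" "k x = 0"
    by auto
  then have mx: "- x \<in> sphere 0 s"
    by simp
  have "g x = g (- x)"
    using x mx Re[OF x(1)] Re[OF mx] by (simp add: k_def complex_eq_iff)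
  then have "f x = f (- x)"
    using g(2) x(1) mx by simp
  then have "x = - x"
    using inj x(1) mx by (auto dest: inj_onD)
  then show False
    using x(1) assms(1) by auto
qed

section \<open>A ring of six tangent discs and its cones\<close>

text \<open>The vertices of a regular hexagon with circumradius 2, listed in cyclic order; its sides
  also have length 2, so unit discs about neighbours are tangent.\<close>

definition centre :: "nat \<Rightarrow> complex" where
  "centre i = [Complex 2 0, Complex 1 (sqrt 3), Complex (-1) (sqrt 3),
     Complex (-2) 0, Complex (-1) (- sqrt 3), Complex 1 (- sqrt 3)] ! i"

definition adjacent :: "nat \<Rightarrow> nat \<Rightarrow> bool" where
  "adjacent i j \<longleftrightarrow> (i, j) \<in> {(0,1),(1,2),(2,3),(3,4),(4,5),(5,0),(1,0),(2,1),(3,2),(4,3),(5,4),(0,5)}"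

lemma less_6_cases: "i < 6 \<longleftrightarrow> i = 0 \<or> i = 1 \<or> i = 2 \<or> i = 3 \<or> i = 4 \<or> i = (5::nat)"
  by auto

lemma norm_centre: "i < 6 \<Longrightarrow> norm (centre i) = 2"
  by (auto simp: less_6_cases centre_def complex_norm)

lemma dist_Complex: "dist (Complex a b) (Complex c d) = sqrt ((a - c)\<^sup>2 + (b - d)\<^sup>2)"
  by (simp add: dist_norm cmod_def)

lemma dist_centre_adjacent: "adjacent i j \<Longrightarrow> dist (centre i) (centre j) = 2"
  by (auto simp: adjacent_def centre_def dist_Complex power2_eq_square)

text \<open>The squared distances are 12 and 16; comparing squares avoids nested roots.\<close>

lemma dist_centre_nonadjacent:
  assumes "i < 6" "j < 6" "i \<noteq> j" "\<not> adjacent i j"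
  shows "2 < dist (centre i) (centre j)"
proof -
  have "4 < (dist (centre i) (centre j))\<^sup>2"
    using assms unfolding less_6_cases
    by (elim disjE) (simp_all add: adjacent_def centre_def dist_Complex power_mult_distrib)
  then show ?thesis
    using power_less_imp_less_base[of 2 2 "dist (centre i) (centre j)"] by simp
qed

lemma cball_centre_Int:
  assumes "adjacent i j"
  shows "cball (centre i) 1 \<inter> cball (centre j) 1 \<noteq> {}"
proof -
  have "midpoint (centre i) (centre j) \<in> cball (centre i) 1 \<inter> cball (centre j) 1"
    using dist_centre_adjacent[OF assms] by (simp add: dist_midpoint)
  then show ?thesis
    by blast
qed

lemma cball_centre_disjoint:
  assumes "i < 6" "j < 6" "i \<noteq> j" "\<not> adjacent i j"
  shows "cball (centre i) 1 \<inter> cball (centre j) 1 = {}"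
  using dist_centre_nonadjacent[OF assms] disjoint_cballI[of 1 1 "centre i" "centre j"] by simp

lemma ball_centre_disjoint:
  assumes "i < 6" "j < 6" "i \<noteq> j"
  shows "ball (centre i) 1 \<inter> ball (centre j) 1 = {}"
proof -
  have "2 \<le> dist (centre i) (centre j)"
    using dist_centre_nonadjacent[OF assms] dist_centre_adjacent[of i j] by fastforce
  then show ?thesis
    using disjoint_ballI[of 1 1 "centre i" "centre j"] by simp
qed

lemma cball_centre_norm:
  assumes "i < 6" "z \<in> cball (centre i) 1"
  shows "1 \<le> norm z" and "norm z \<le> 3"
  using assms(2) norm_centre[OF assms(1)] norm_triangle_ineq2[of "centre i" z] norm_triangle_ineq2[of z "centre i"]
  by (auto simp: dist_norm norm_minus_commute)

text \<open>The circle passes through the tangency points. On it, lying in disc \<open>i\<close>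
  amounts to an inner product of at least 3 with \<open>centre i\<close>, which is what the six
  inequalities express. If all failed, \<open>3 * x^2 + t^2\<close> would be less than 9.\<close>

lemma sphere_subset_cballs:
  assumes "norm z = sqrt 3"
  obtains i where "i < 6" "z \<in> cball (centre i) 1"
proof -
  obtain x y where z: "z = Complex x y"
    using complex.exhaust by blast
  define t where "t = sqrt 3 * y"
  have s: "x^2 + y^2 = 3"
    using assms by (simp add: z complex_norm)
  have "t^2 = 3 * y^2"
    by (simp add: t_def power_mult_distrib)
  then have st: "3 * x^2 + t^2 = 9"
    using s by simp
  have in_cball: "dist (Complex p q) (Complex x y) \<le> 1 \<longleftrightarrow> (p - x)^2 + (q - y)^2 \<le> 1" for p q
    by (simp add: dist_Complex)
  have "2 * x \<ge> 3 \<or> x + t \<ge> 3 \<or> - x + t \<ge> 3 \<or> - 2 * x \<ge> 3 \<or> - x - t \<ge> 3 \<or> x - t \<ge> 3"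
  proof (rule ccontr)
    assume "\<not> ?thesis"
    then have "\<bar>x\<bar> < 3/2" "\<bar>t\<bar> < 3 - \<bar>x\<bar>"
      by (auto simp: abs_if)
    then have "\<bar>t\<bar>^2 < (3 - \<bar>x\<bar>)^2" "\<bar>x\<bar> * \<bar>x\<bar> \<le> \<bar>x\<bar> * (3/2)"
      by (intro power_strict_mono mult_left_mono; simp)+
    then show False
      using st by (simp add: power2_eq_square algebra_simps)
  qed
  moreover have "z \<in> cball (centre 0) 1" if "2 * x \<ge> 3"
    using that s by (simp add: z centre_def in_cball power2_eq_square algebra_simps)
  moreover have "z \<in> cball (centre 1) 1" if "x + t \<ge> 3"
    using that s by (simp add: z centre_def in_cball power2_eq_square algebra_simps t_def)
  moreover have "z \<in> cball (centre 2) 1" if "- x + t \<ge> 3"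
    using that s by (simp add: z centre_def in_cball power2_eq_square algebra_simps t_def)
  moreover have "z \<in> cball (centre 3) 1" if "- 2 * x \<ge> 3"
    using that s by (simp add: z centre_def in_cball power2_eq_square algebra_simps)
  moreover have "z \<in> cball (centre 4) 1" if "- x - t \<ge> 3"
    using that s by (simp add: z centre_def in_cball power2_eq_square algebra_simps t_def)
  moreover have "z \<in> cball (centre 5) 1" if "x - t \<ge> 3"
    using that s by (simp add: z centre_def in_cball power2_eq_square algebra_simps t_def)
  ultimately obtain i where "i \<in> {0,1,2,3,4,5}" "z \<in> cball (centre i) 1"
    by blast
  then show thesis
    using that[of i] by auto
qed

text \<open>Index 6 stands for the well over the sealing disc, which touches none of the other cells.\<close>

definition height :: "nat \<Rightarrow> real" where
  "height i = [3, -1, 2, -3, 1, -2, -10] ! i"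

definition cones :: "complex \<Rightarrow> real" where
  "cones z = (\<Sum>i<6. height i * max 0 (1 - dist z (centre i)))"

lemma continuous_on_cones: "continuous_on S cones"
  unfolding cones_def by (intro continuous_intros)

lemma cones_ball:
  assumes "i < 6" and "z \<in> ball (centre i) 1"
  shows "cones z = height i * (1 - dist z (centre i))"
proof -
  have "max 0 (1 - dist z (centre j)) = 0" if "j < 6" "j \<noteq> i" for j
    using ball_centre_disjoint[OF that(1) assms(1) that(2)] assms(2)
    by (force simp: dist_commute)
  then have "cones z = (\<Sum>j<6. if j = i then height i * max 0 (1 - dist z (centre i)) else 0)"
    unfolding cones_def by (intro sum.cong) auto
  then show ?thesis
    using assms by (simp add: dist_commute)
qed

lemma cones_outside:
  assumes "\<And>i. i < 6 \<Longrightarrow> z \<notin> ball (centre i) 1"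
  shows "cones z = 0"
  using assms unfolding cones_def by (intro sum.neutral) (auto simp: dist_commute not_less)

lemma adjacent_less: "adjacent i j \<Longrightarrow> i < 6 \<and> j < 6"
  by (auto simp: adjacent_def)

lemma adjacent_iffs:
  "adjacent 0 j \<longleftrightarrow> j = 1 \<or> j = 5" "adjacent 2 j \<longleftrightarrow> j = 1 \<or> j = 3"
  "adjacent 3 j \<longleftrightarrow> j = 2 \<or> j = 4" "adjacent 5 j \<longleftrightarrow> j = 4 \<or> j = 0"
  "adjacent j 0 \<longleftrightarrow> j = 1 \<or> j = 5" "adjacent j 2 \<longleftrightarrow> j = 1 \<or> j = 3"
  "adjacent j 3 \<longleftrightarrow> j = 2 \<or> j = 4" "adjacent j 5 \<longleftrightarrow> j = 4 \<or> j = 0"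
  by (auto simp: adjacent_def)

lemma height_simps [simp]:
  "height 0 = 3" "height 1 = -1" "height (Suc 0) = -1" "height 2 = 2" "height 3 = -3"
  "height 4 = 1" "height 5 = -2" "height 6 = -10"
  by (simp_all add: height_def)

text \<open>Indices 0 and 3 carry the extreme heights of their sign within the ring, so they are
  fixed. The neighbours 5 of 0 and 2 of 3 are then fixed because the other available neighbour is
  too low. Finally 1 and 4 are the only common neighbours of fixed indices.\<close>

lemma height_preserving_cycle_map:
  fixes \<sigma> :: "nat \<Rightarrow> nat"
  assumes sgn: "\<And>i. i < 6 \<Longrightarrow> sgn (height (\<sigma> i)) = sgn (height i)"
    and height: "\<And>i. i < 6 \<Longrightarrow> \<bar>height i\<bar> \<le> \<bar>height (\<sigma> i)\<bar>"
    and adj: "\<And>i j. adjacent i j \<Longrightarrow> adjacent (\<sigma> i) (\<sigma> j)"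
    and "i < 6"
  shows "\<sigma> i = i"
proof -
  have a: "adjacent (\<sigma> 0) (\<sigma> 1)" "adjacent (\<sigma> 1) (\<sigma> 2)" "adjacent (\<sigma> 2) (\<sigma> 3)"
    "adjacent (\<sigma> 3) (\<sigma> 4)" "adjacent (\<sigma> 4) (\<sigma> 5)" "adjacent (\<sigma> 5) (\<sigma> 0)"
    by (rule adj, simp add: adjacent_def)+
  \<comment> \<open>Adjacency never involves index 6, which rules out the deep well as a target;
    sign and height alone would admit it for negative cells.\<close>
  have lt: "\<sigma> 0 < 6" "\<sigma> 1 < 6" "\<sigma> 2 < 6" "\<sigma> 3 < 6" "\<sigma> 4 < 6" "\<sigma> 5 < 6"
    using a adjacent_less by blast+
  have 0: "\<sigma> 0 = 0"
    using sgn[of 0] height[of 0] lt(1) unfolding less_6_cases by auto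
  have 3: "\<sigma> 3 = 3"
    using sgn[of 3] height[of 3] lt(4) unfolding less_6_cases by auto
  have "\<sigma> 2 = 2 \<or> \<sigma> 2 = 4"
    using a(3) unfolding 3 adjacent_iffs .
  then have 2: "\<sigma> 2 = 2"
    using height[of 2] by auto
  have "\<sigma> 5 = 1 \<or> \<sigma> 5 = 5"
    using a(6) unfolding 0 adjacent_iffs .
  then have 5: "\<sigma> 5 = 5"
    using height[of 5] by auto
  have 1: "\<sigma> 1 = 1"
    using a(1,2) unfolding 0 2 adjacent_iffs by auto
  have 4: "\<sigma> 4 = 4"
    using a(4,5) unfolding 3 5 adjacent_iffs by auto
  show ?thesis
    using 0 1 2 3 4 5 \<open>i < 6\<close> unfolding less_6_cases by (elim disjE) simp_all
qed

section \<open>Rigidity of maps that preserve the bumps\<close>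

lemma connectedin_subset_disjoint_Union:
  assumes S: "connectedin X S" "S \<noteq> {}" "S \<subseteq> (\<Union>i\<in>I. U i)"
    and op: "\<And>i. i \<in> I \<Longrightarrow> openin X (U i)"
    and disj: "\<And>i j. i \<in> I \<Longrightarrow> j \<in> I \<Longrightarrow> i \<noteq> j \<Longrightarrow> U i \<inter> U j = {}"
  obtains i where "i \<in> I" "S \<subseteq> U i"
proof -
  obtain i where i: "i \<in> I" "S \<inter> U i \<noteq> {}"
    using S(2,3) by blast
  let ?V = "\<Union>j\<in>I - {i}. U j"
  have "openin X ?V"
    using op by auto
  moreover have "S \<subseteq> U i \<union> ?V"
    using S(3) by blast
  moreover have "U i \<inter> ?V = {}"
    using disj i(1) by blast
  ultimately have "S \<inter> ?V = {}"
    using connectedinD[OF S(1) op[OF i(1)], of ?V] i(2) by blast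
  then show thesis
    using that[of i] i(1) \<open>S \<subseteq> U i \<union> ?V\<close> by blast
qed

text \<open>Each connected open cell is sent into one open cell, since \<open>f\<close> stays
  nonzero; this defines an index map \<open>\<sigma>\<close>. Peaks control its heights and touching
  closures its adjacencies, so \<open>\<sigma>\<close> is the identity on the ring. Connectedness
  and a peak are required for \<open>i < 6\<close> only, so cell 6 may be empty.\<close>

lemma necklace_rigidity:
  fixes f :: "'a \<Rightarrow> real"
  assumes r: "continuous_map X X r" and fr: "\<And>x. x \<in> topspace X \<Longrightarrow> f (r x) = f x"
    and B: "\<And>i. i \<le> 6 \<Longrightarrow> openin X (B i)" "\<And>i. i < 6 \<Longrightarrow> connectedin X (B i)"
    and K: "\<And>i. i \<le> 6 \<Longrightarrow> closedin X (K i)" "\<And>i. i \<le> 6 \<Longrightarrow> B i \<subseteq> K i"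
      "\<And>i. i < 6 \<Longrightarrow> K i \<subseteq> X closure_of B i"
    and disj: "\<And>i j. i \<le> 6 \<Longrightarrow> j \<le> 6 \<Longrightarrow> i \<noteq> j \<Longrightarrow> B i \<inter> B j = {}"
    and touch: "\<And>i j. adjacent i j \<Longrightarrow> K i \<inter> K j \<noteq> {}"
    and apart: "\<And>i j. i \<le> 6 \<Longrightarrow> j \<le> 6 \<Longrightarrow> i \<noteq> j \<Longrightarrow> \<not> adjacent i j \<Longrightarrow> K i \<inter> K j = {}"
    and sgn: "\<And>i x. i \<le> 6 \<Longrightarrow> x \<in> B i \<Longrightarrow> sgn (f x) = sgn (height i) \<and> \<bar>f x\<bar> \<le> \<bar>height i\<bar>"
    and top: "\<And>i. i < 6 \<Longrightarrow> \<exists>x\<in>B i. f x = height i"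
    and zero: "\<And>x. x \<in> topspace X \<Longrightarrow> x \<notin> (\<Union>i\<le>6. B i) \<Longrightarrow> f x = 0"
    and i: "i < 6"
  shows "r ` K i \<subseteq> K i"
proof -
  have rX: "r x \<in> topspace X" if "x \<in> topspace X" for x
    using r that by (auto simp: continuous_map_def)
  have BX: "B i \<subseteq> topspace X" if "i \<le> 6" for i
    using B(1)[OF that] openin_subset by blast
  have h0: "height i \<noteq> 0" if "i < 6" for i
    using that unfolding less_6_cases by auto
  have "\<exists>j\<le>6. r ` B i \<subseteq> B j" if i: "i < 6" for i
  proof -
    have "r x \<in> (\<Union>i\<in>{..6}. B i)" if x: "x \<in> B i" for x
    proof -
      have "x \<in> topspace X" "f x \<noteq> 0"
        using sgn[of i x] h0[OF i] i x BX[of i] by (auto simp: sgn_if split: if_splits)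
      then show ?thesis
        using zero[OF rX] fr by auto
    qed
    moreover have "connectedin X (r ` B i)"
      using connectedin_continuous_map_image[OF r B(2)[OF i]] .
    moreover have "r ` B i \<noteq> {}"
      using top[OF i] by auto
    ultimately obtain j where "j \<in> {..6}" "r ` B i \<subseteq> B j"
      using connectedin_subset_disjoint_Union[of X "r ` B i" B "{..6}"] B(1) disj
      by (metis atMost_iff image_subsetI)
    then show ?thesis by auto
  qed
  then obtain \<sigma> where \<sigma>: "\<And>i. i < 6 \<Longrightarrow> \<sigma> i \<le> 6 \<and> r ` B i \<subseteq> B (\<sigma> i)"
    by metis
  \<comment> \<open>Tangency is visible only on closed cells, so the inclusion is passed to
    closures.\<close>
  have rK: "r ` K i \<subseteq> K (\<sigma> i)" if i: "i < 6" for i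
  proof -
    have "r ` K i \<subseteq> r ` (X closure_of B i)"
      using K(3)[OF i] by blast
    also have "\<dots> \<subseteq> X closure_of (r ` B i)"
      using r continuous_map_image_closure_subset by blast
    also have "\<dots> \<subseteq> K (\<sigma> i)"
      by (rule closure_of_minimal) (use \<sigma>[OF i] K in blast)+
    finally show ?thesis .
  qed
  have h: "sgn (height (\<sigma> i)) = sgn (height i) \<and> \<bar>height i\<bar> \<le> \<bar>height (\<sigma> i)\<bar>" if i: "i < 6" for i
  proof -
    obtain x where x: "x \<in> B i" "f x = height i"
      using top[OF i] by blast
    then have "f (r x) = height i"
      using fr BX[of i] i by auto
    moreover have "r x \<in> B (\<sigma> i)"
      using \<sigma>[OF i] x by auto
    ultimately show ?thesis
      using sgn[of "\<sigma> i" "r x"] \<sigma>[OF i] by auto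
  qed
  have "adjacent (\<sigma> i) (\<sigma> j)" if ij: "adjacent i j" for i j
  proof (rule ccontr)
    assume "\<not> adjacent (\<sigma> i) (\<sigma> j)"
    \<comment> \<open>Signs alternate around the ring, so neighbours cannot be sent into one common
      cell.\<close>
    have lt: "i < 6" "j < 6" and "sgn (height i) \<noteq> sgn (height j)"
      using ij adjacent_less[OF ij] by (auto simp: adjacent_def)
    then have "\<sigma> i \<noteq> \<sigma> j"
      using h by metis
    then have "K (\<sigma> i) \<inter> K (\<sigma> j) = {}"
      using apart \<sigma> lt \<open>\<not> adjacent (\<sigma> i) (\<sigma> j)\<close> by blast
    then show False
      using rK[OF lt(1)] rK[OF lt(2)] touch[OF ij] by blast
  qed
  then have "\<sigma> i = i"
    using height_preserving_cycle_map[of \<sigma> i] h i by blast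
  then show ?thesis
    using rK[OF i] by simp
qed

section \<open>Pipes with a possibly empty cap\<close>

lemma Lindelof_space_Un:
  assumes "Lindelof_space (subtopology X S)" and "Lindelof_space (subtopology X T)"
  shows "Lindelof_space (subtopology X (S \<union> T))"
  using Lindelof_space_Union[of "{S, T}" X] assms by auto

lemma compactin_imp_Lindelof_space: "compactin X K \<Longrightarrow> Lindelof_space (subtopology X K)"
  by (simp add: compact_imp_Lindelof_space compact_space_subtopology)

text \<open>The cap \<open>D\<close> is the sealing disc, or empty for a longpipe. The function \<open>q\<close> is 1 minus the
radius in the disc; the last assumption is radial extension of \<open>w\<close> over the disc.\<close>

locale capped_pipe =
  fixes X :: "'a topology" and L D :: "'a set" and q :: "'a \<Rightarrow> real"
  assumes hausdorff: "Hausdorff_space X"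
    and closed: "closedin X L" "closedin X D" and cover: "L \<union> D = topspace X"
    and exhausted: "annularly_exhausted (subtopology X L)"
    and off_cap: "annular_chart (subtopology X L) E e g \<Longrightarrow> z \<in> ann \<Longrightarrow> 1/2 < norm z \<Longrightarrow> e z \<notin> D"
    and compact_seam: "compactin X (L \<inter> D)"
    and q: "continuous_map X euclideanreal q" "\<And>x. x \<in> L \<Longrightarrow> q x = 0"
      "\<And>x. x \<in> D - L \<Longrightarrow> 0 < q x \<and> q x \<le> 1"
    and extend: "\<And>Y (w :: 'a \<Rightarrow> complex). L \<inter> D \<subseteq> Y \<Longrightarrow> Y \<subseteq> L \<Longrightarrow>
       continuous_map (subtopology X Y) euclidean w \<Longrightarrow> 0 \<notin> w ` Y \<Longrightarrow>
       \<exists>k. continuous_map (subtopology X (Y \<union> D)) euclidean k \<and> (\<forall>x\<in>Y. k x = w x) \<and>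
         (\<forall>x\<in>D. k x = 0 \<longrightarrow> q x = 1)"
begin

lemma L_subset: "L \<subseteq> topspace X"
  using cover by blast

lemma topspace_L: "topspace (subtopology X L) = L"
  using L_subset by auto

text \<open>The set \<open>Q\<close> may reach into the cap, but its trace on the closed set
  \<open>L\<close> is closed in \<open>Q\<close> and hence still Lindelof.\<close>

lemma exhaust:
  assumes Q: "Q \<subseteq> topspace X" "Lindelof_space (subtopology X Q)"
  obtains E e g K where "Q \<inter> L \<subseteq> E" "E \<subseteq> K" "compactin X K" "K \<subseteq> L" "annular_chart (subtopology X L) E e g"
proof -
  have "closedin (subtopology X Q) (Q \<inter> L)"
    using closed(1) by (simp add: closedin_subtopology_Int_closed)
  then have "Lindelof_space (subtopology X (Q \<inter> L))"
    using Lindelof_space_closedin_subtopology[OF Q(2), of "Q \<inter> L"]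
    by (simp add: subtopology_subtopology Int_absorb1)
  then have "Lindelof_space (subtopology (subtopology X L) (Q \<inter> L))"
    by (simp add: subtopology_subtopology Int_absorb1 inf_commute)
  then obtain E e g K where "Q \<inter> L \<subseteq> E" "E \<subseteq> K" "compactin (subtopology X L) K"
    "annular_chart (subtopology X L) E e g"
    using exhausted unfolding annularly_exhausted_def by (metis Int_lower2 topspace_L)
  then show thesis
    using that by (auto simp: compactin_subtopology)
qed

end

section \<open>The bump function in a chart of a capped pipe\<close>

locale capped_pipe_chart = capped_pipe +
  fixes E e g
  assumes chart: "annular_chart (subtopology X L) E e g"
begin

lemmas chartD = annular_chartD[OF chart]

lemma E_L: "E \<subseteq> L"
  using chartD(2) topspace_L by simp

lemma continuous_e: "continuous_map (top_of_set ann) X e"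
  using chartD(3) by (simp add: continuous_map_in_subtopology)

lemma continuous_g: "continuous_map (subtopology X E) (top_of_set ann) g"
  using chartD(5) E_L by (simp add: subtopology_subtopology Int_absorb1)

text \<open>The chart yields openness relative to \<open>L\<close> only. Off the inner circle the
  image misses \<open>D\<close>, and the complement of the closed set \<open>D\<close> is open in
  \<open>X\<close> and contained in \<open>L\<close>.\<close>

lemma openin_chart_image:
  assumes "open U" and "U \<subseteq> ann" and "\<And>z. z \<in> U \<Longrightarrow> 1/2 < norm z"
  shows "openin X (e ` U)"
proof -
  have "openin (top_of_set ann) U"
    using assms(1,2) by (metis open_subset)
  then have "openin (subtopology (subtopology X L) E) {x \<in> topspace (subtopology (subtopology X L) E). g x \<in> U}"
    using openin_continuous_map_preimage[OF chartD(5)] by blast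
  moreover have "{x \<in> topspace (subtopology (subtopology X L) E). g x \<in> U} = e ` U"
  proof -
    have "topspace (subtopology (subtopology X L) E) = E"
      using chartD(2) by (simp add: Int_absorb1)
    moreover have "{x \<in> E. g x \<in> U} = e ` U"
    proof (intro equalityI subsetI)
      fix x assume "x \<in> {x \<in> E. g x \<in> U}"
      then show "x \<in> e ` U"
        using chartD(8)[of x] by (metis (mono_tags) image_eqI mem_Collect_eq)
    next
      fix x assume "x \<in> e ` U"
      then obtain z where z: "x = e z" "z \<in> U" by blast
      then have "z \<in> ann" using assms(2) by blast
      then show "x \<in> {x \<in> E. g x \<in> U}"
        using z chartD(4) chartD(7)[of z] by auto
    qed
    ultimately show ?thesis by simp
  qed
  ultimately have "openin (subtopology X L) (e ` U)"
    using openin_trans_full[OF _ chartD(1)] by simp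
  then obtain T where T: "openin X T" "e ` U = T \<inter> L"
    by (auto simp: openin_subtopology)
  have "e ` U \<inter> D = {}"
    using off_cap[OF chart] assms(2,3) by blast
  then have "e ` U = T \<inter> (topspace X - D)"
    using T openin_subset[OF T(1)] cover by blast
  then show ?thesis
    using T(1) closed(2) by auto
qed

lemma closedin_chart_image:
  assumes "compact C" and "C \<subseteq> ann"
  shows "closedin X (e ` C)"
proof -
  have "compactin (top_of_set ann) C"
    using assms by (simp add: compactin_subtopology)
  then show ?thesis
    using image_compactin[OF _ continuous_e] compactin_imp_closedin[OF hausdorff] by blast
qed

text \<open>Since the cones have absolute value at most 3 and \<open>q\<close> vanishes on
  \<open>L\<close>, the value -10 occurs exactly where \<open>q\<close> is 1.\<close>

definition bumps :: "'a \<Rightarrow> real" where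
  "bumps x = (if x \<in> E then cones (g x) else 0) - 10 * q x"

lemma ball_centre_ann: "i < 6 \<Longrightarrow> cball (centre i) 1 \<subseteq> ann"
  using cball_centre_norm by (fastforce simp: ann_def simp del: mem_cball)

text \<open>The cones vanish off the compact ring of radii 1 to 3, so \<open>cones \<circ> g\<close>
  on the open part of the chart and zero off that ring agree on the overlap of two open sets
  covering \<open>X\<close>.\<close>

lemma continuous_bumps: "continuous_map X euclideanreal bumps"
proof -
  let ?C = "{z::complex. 1 \<le> norm z \<and> norm z \<le> 3}"
  let ?O = "e ` (ann \<inter> {z. 1/2 < norm z})"
  let ?f = "\<lambda>x. if x \<in> E then cones (g x) else 0"
  have "?C = cball 0 3 - ball 0 1"
    by auto
  then have C: "compact ?C" "?C \<subseteq> ann"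
    by (auto simp: compact_diff ann_def)
  have zero: "?f x = 0" if "x \<notin> e ` ?C" for x
  proof (cases "x \<in> E")
    case True
    then have "g x \<notin> ?C"
      using that chartD(8) by (metis image_eqI)
    then have "g x \<notin> ball (centre i) 1" if "i < 6" for i
      using cball_centre_norm[OF that, of "g x"] ball_subset_cball[of "centre i" 1] by blast
    then show ?thesis
      using cones_outside by simp
  qed auto
  have "continuous_map X euclideanreal ?f"
  proof (rule pasting_lemma[where I = UNIV and T = "\<lambda>b. if b then ?O else topspace X - e ` ?C"
        and f = "\<lambda>b x. if b then cones (g x) else 0"])
    fix b :: bool
    show "openin X (if b then ?O else topspace X - e ` ?C)"
      using openin_chart_image[OF open_ann_interior] closedin_chart_image[OF C] by auto
    show "continuous_map (subtopology X (if b then ?O else topspace X - e ` ?C)) euclideanreal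
        (\<lambda>x. if b then cones (g x) else 0)"
    proof (cases b)
      case True
      have "continuous_map (subtopology X ?O) (top_of_set ann) g"
        using continuous_g chartD(4) by (auto intro: continuous_map_from_subtopology_mono)
      moreover have "continuous_map (top_of_set ann) euclideanreal cones"
        by (simp add: continuous_on_cones)
      ultimately show ?thesis
        using True continuous_map_compose[of _ _ g _ cones] by (simp add: o_def)
    qed auto
  next
    fix b c x assume "x \<in> topspace X \<inter> (if b then ?O else topspace X - e ` ?C) \<inter> (if c then ?O else topspace X - e ` ?C)"
    then show "(if b then cones (g x) else 0) = (if c then cones (g x) else 0)"
      using zero[of x] chartD(4) by (auto split: if_splits)
  next
    fix x assume x: "x \<in> topspace X"
    show "\<exists>b. b \<in> UNIV \<and> x \<in> (if b then ?O else topspace X - e ` ?C) \<and> ?f x = (if b then cones (g x) else 0)"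
    proof (cases "x \<in> e ` ?C")
      case True
      then have "x \<in> ?O" "x \<in> E"
        using C(2) chartD(4) by auto
      then show ?thesis
        by (intro exI[of _ True]) auto
    next
      case False
      then show ?thesis
        using x zero[OF False] by (intro exI[of _ False]) auto
    qed
  qed
  then show ?thesis
    unfolding bumps_def using q(1) by (intro continuous_intros) auto
qed

text \<open>Index 6 is the open cap. Without a cap it is empty, so both kinds of pipe are treated
  with the same seven indices.\<close>

definition cell :: "nat \<Rightarrow> 'a set" where
  "cell i = (if i < 6 then e ` ball (centre i) 1 else {x \<in> topspace X. 0 < q x})"

definition closed_cell :: "nat \<Rightarrow> 'a set" where
  "closed_cell i = (if i < 6 then e ` cball (centre i) 1 else D)"

lemma cball_off_cap: "i < 6 \<Longrightarrow> e ` cball (centre i) 1 \<inter> D = {}"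
proof -
  assume i: "i < 6"
  have "e z \<notin> D" if "z \<in> cball (centre i) 1" for z
  proof (rule off_cap[OF chart])
    show "z \<in> ann"
      using ball_centre_ann[OF i] that by blast
    show "1/2 < norm z"
      using cball_centre_norm(1)[OF i that] by simp
  qed
  then show ?thesis
    by blast
qed

lemma inj_e: "inj_on e ann"
  using chartD(7) inj_on_inverseI by metis

lemma positive_subset_cap: "{x \<in> topspace X. 0 < q x} \<subseteq> D - L"
  using q(2) cover by fastforce

lemma bumps_cell:
  assumes "i < 6" and "z \<in> ball (centre i) 1"
  shows "bumps (e z) = height i * (1 - dist z (centre i))"
proof -
  have "z \<in> ann"
    using ball_centre_ann[OF assms(1)] assms(2) by auto
  then show ?thesis
    using cones_ball[OF assms] chartD(4,7) E_L q(2) by (auto simp: bumps_def)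
qed

text \<open>An instance of \<open>necklace_rigidity\<close>: injectivity of \<open>e\<close> and the
  distance of the discs from the cap transfer the incidences of the plane discs to
  \<open>X\<close>.\<close>

lemma retraction_preserves_closed_cell:
  assumes r: "continuous_map X X r" and fr: "\<And>x. x \<in> topspace X \<Longrightarrow> bumps (r x) = bumps x"
    and i: "i < 6"
  shows "r ` e ` cball (centre i) 1 \<subseteq> e ` cball (centre i) 1"
proof -
  have "r ` closed_cell i \<subseteq> closed_cell i"
  proof (rule necklace_rigidity[where f = bumps and B = cell, OF r fr])
    fix i :: nat assume i: "i \<le> 6"
    show "openin X (cell i)"
    proof (cases "i < 6")
      case True
      have "openin X (e ` ball (centre i) 1)"
      proof (rule openin_chart_image)
        show "ball (centre i) 1 \<subseteq> ann"
          using ball_centre_ann[OF True] ball_subset_cball by blast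
        show "1/2 < norm z" if "z \<in> ball (centre i) 1" for z
          using cball_centre_norm(1)[OF True, of z] that ball_subset_cball[of "centre i" 1]
          by (smt (verit, best) subset_iff divide_less_eq_1)
      qed simp
      then show ?thesis
        using True by (simp add: cell_def)
    next
      case False
      have "openin X {x \<in> topspace X. q x \<in> {0<..}}"
        using openin_continuous_map_preimage[OF q(1), of "{0<..}"] by simp
      then show ?thesis
        using False by (simp add: cell_def)
    qed
    show "closedin X (closed_cell i)"
      using closedin_chart_image[OF _ ball_centre_ann] closed(2) by (simp add: closed_cell_def)
    show "cell i \<subseteq> closed_cell i"
      using positive_subset_cap ball_subset_cball by (auto simp: cell_def closed_cell_def)
    show "sgn (bumps x) = sgn (height i) \<and> \<bar>bumps x\<bar> \<le> \<bar>height i\<bar>" if x: "x \<in> cell i" for x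
    proof (cases "i < 6")
      case True
      then obtain z where z: "z \<in> ball (centre i) 1" "x = e z"
        using x by (auto simp: cell_def)
      then have "0 < 1 - dist z (centre i)" "1 - dist z (centre i) \<le> 1"
        by (auto simp: dist_commute)
      then show ?thesis
        using bumps_cell[OF True z(1)] z(2)
        by (auto simp: sgn_mult abs_mult intro: mult_left_le)
    next
      case False
      then have "i = 6" using i by auto
      moreover have "x \<in> D - L"
        using x positive_subset_cap False by (auto simp: cell_def)
      ultimately show ?thesis
        using q(3)[of x] E_L by (auto simp: bumps_def)
    qed
  next
    fix i :: nat assume i: "i < 6"
    have "connectedin (top_of_set ann) (ball (centre i) 1)"
      using ball_centre_ann[OF i] ball_subset_cball by (force simp: connectedin_subtopology)
    then show "connectedin X (cell i)"
      using i connectedin_continuous_map_image[OF continuous_e] by (simp add: cell_def)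
    have "ann \<inter> ball (centre i) 1 = ball (centre i) 1"
      using ball_centre_ann[OF i] ball_subset_cball by blast
    then have "top_of_set ann closure_of ball (centre i) 1 = cball (centre i) 1"
      using ball_centre_ann[OF i] by (simp add: closure_of_subtopology Int_absorb1)
    then show "closed_cell i \<subseteq> X closure_of cell i"
      using continuous_map_image_closure_subset[OF continuous_e, of "ball (centre i) 1"] i
      by (simp add: cell_def closed_cell_def)
    show "\<exists>x\<in>cell i. bumps x = height i"
      using i bumps_cell[OF i, of "centre i"] by (auto simp: cell_def)
  next
    fix i j :: nat assume ij: "i \<le> 6" "j \<le> 6" "i \<noteq> j"
    have D: "e ` ball (centre i) 1 \<inter> {x \<in> topspace X. 0 < q x} = {}" if "i < 6" for i
      using cball_off_cap[OF that] positive_subset_cap ball_subset_cball[of "centre i" 1] by blast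
    show "cell i \<inter> cell j = {}"
    proof (cases "i < 6 \<and> j < 6")
      case True
      then have "e ` ball (centre i) 1 \<inter> e ` ball (centre j) 1 = {}"
        using ball_centre_disjoint[of i j] ij ball_centre_ann[of i] ball_centre_ann[of j]
          inj_on_image_Int[OF inj_e, of "ball (centre i) 1" "ball (centre j) 1"]
          subset_trans[OF ball_subset_cball[of "centre i" 1]] subset_trans[OF ball_subset_cball[of "centre j" 1]]
        by simp
      then show ?thesis
        using True by (simp add: cell_def)
    next
      case False
      then show ?thesis
        using D[of i] D[of j] ij unfolding cell_def
        by (cases "i < 6"; cases "j < 6"; simp add: Int_commute)
    qed
    assume nadj: "\<not> adjacent i j"
    show "closed_cell i \<inter> closed_cell j = {}"
    proof (cases "i < 6 \<and> j < 6")
      case True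
      then have "e ` cball (centre i) 1 \<inter> e ` cball (centre j) 1 = {}"
        using cball_centre_disjoint[of i j] ij nadj ball_centre_ann[of i] ball_centre_ann[of j]
          inj_on_image_Int[OF inj_e, of "cball (centre i) 1" "cball (centre j) 1"] by simp
      then show ?thesis
        using True by (simp add: closed_cell_def)
    next
      case False
      then show ?thesis
        using cball_off_cap[of i] cball_off_cap[of j] ij unfolding closed_cell_def
        by (cases "i < 6"; cases "j < 6"; simp add: Int_commute)
    qed
  next
    fix i j assume "adjacent i j"
    then show "closed_cell i \<inter> closed_cell j \<noteq> {}"
      using adjacent_less[of i j] cball_centre_Int[of i j] by (auto simp: closed_cell_def)
  next
    fix x assume x: "x \<in> topspace X" "x \<notin> (\<Union>i\<le>6. cell i)"
    then have "x \<notin> cell 6"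
      by blast
    then have "q x = 0"
      using q(2,3)[of x] x(1) cover by (auto simp: cell_def)
    moreover have "cones (g x) = 0" if "x \<in> E"
    proof (rule cones_outside)
      fix i :: nat assume i: "i < 6"
      then have "x \<notin> e ` ball (centre i) 1"
        using x(2) UN_I[of i "{..6}" x cell] by (auto simp: cell_def)
      then show "g x \<notin> ball (centre i) 1"
        using chartD(8)[OF that] by (metis image_eqI)
    qed
    ultimately show "bumps x = 0"
      by (simp add: bumps_def)
  qed (use i in auto)
  then show ?thesis
    using i by (simp add: closed_cell_def)
qed

end

section \<open>Homotopies in the annulus and the contradiction\<close>

lemma abs_cones_le: "\<bar>cones z\<bar> \<le> 3"
proof (cases "\<exists>i<6. z \<in> ball (centre i) 1")
  case True
  then obtain i where i: "i < 6" "z \<in> ball (centre i) 1" by blast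
  have "\<bar>height i\<bar> \<le> 3"
    using i(1) unfolding less_6_cases by auto
  moreover have "\<bar>1 - dist z (centre i)\<bar> \<le> 1"
    using i(2) by (auto simp: dist_commute)
  ultimately have "\<bar>height i\<bar> * \<bar>1 - dist z (centre i)\<bar> \<le> 3 * 1"
    by (intro mult_mono) auto
  then show ?thesis
    using cones_ball[OF i] by (simp add: abs_mult)
next
  case False
  then show ?thesis
    using cones_outside[of z] by auto
qed

text \<open>Homotopies are built by segments inside \<open>ann\<close> and then pushed into the
  punctured plane by a nowhere vanishing \<open>h\<close>.\<close>

lemma homotopic_through_map:
  assumes "homotopic_with_canon (\<lambda>_. True) S A f g"
    and "continuous_on A h" and "\<And>z. z \<in> A \<Longrightarrow> h z \<noteq> (0::complex)"
    and "\<And>x. x \<in> S \<Longrightarrow> f' x = h (f x)" and "\<And>x. x \<in> S \<Longrightarrow> g' x = h (g x)"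
  shows "homotopic_with_canon (\<lambda>_. True) S (-{0}) f' g'"
proof (rule homotopic_with_eq)
  show "homotopic_with_canon (\<lambda>_. True) S (-{0}) (h \<circ> f) (h \<circ> g)"
    by (rule homotopic_with_compose_continuous_left[OF assms(1,2)]) (use assms(3) in auto)
qed (use assms in auto)

text \<open>The annulus is not convex, but along a segment of a ray from the origin the norm is
  affine and stays between its end values.\<close>

lemma closed_segment_scaleR_ann:
  assumes "z \<in> ann" and "c *\<^sub>R z \<in> ann" and "c \<ge> 0"
  shows "closed_segment z (c *\<^sub>R z) \<subseteq> ann"
proof
  fix y assume "y \<in> closed_segment z (c *\<^sub>R z)"
  then obtain u where u: "0 \<le> u" "u \<le> 1" "y = (1 - u) *\<^sub>R z + u *\<^sub>R c *\<^sub>R z"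
    by (auto simp: closed_segment_def)
  then have "y = (1 - u + u * c) *\<^sub>R z"
    by (simp add: algebra_simps)
  moreover have "0 \<le> 1 - u + u * c"
    using u(1,2) assms(3) by simp
  ultimately have "norm y = (1 - u + u * c) * norm z"
    by simp
  then have y: "norm y = (1 - u) * norm z + u * (c * norm z)"
    by (simp add: algebra_simps)
  have b: "1/2 \<le> norm z" "norm z < 4" "1/2 \<le> c * norm z" "c * norm z < 4"
    using assms by (auto simp: ann_def)
  have "norm y \<in> closed_segment (norm z) (c * norm z)"
    using u(1,2) y by (auto simp: closed_segment_def)
  then show "y \<in> ann"
    using b by (auto simp: ann_def closed_segment_eq_real_ivl split: if_splits)
qed

context capped_pipe
begin

theorem EC_imp_not_aS:
  assumes EC: "EC X euclideanreal"
  shows "\<not> aS X euclideanreal"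
proof
  assume aS: "aS X euclideanreal"
  \<comment> \<open>The first chart only has to carry the bumps, so any chart will do and the empty
    set is exhausted.\<close>
  have "Lindelof_space (subtopology X {})"
    using compactin_imp_Lindelof_space compactin_empty by blast
  then obtain E e g K where K: "E \<subseteq> K" "compactin X K" "K \<subseteq> L"
    and chart: "annular_chart (subtopology X L) E e g"
    by (rule exhaust[OF empty_subsetI])
  interpret capped_pipe_chart X L D q E e g
    by (intro capped_pipe_chart.intro capped_pipe_axioms capped_pipe_chart_axioms.intro chart)
  obtain Z r where Z: "Z \<subseteq> topspace X" "Lindelof_space (subtopology X Z)"
    and "continuous_map X (subtopology X Z) r" and fr: "\<And>x. x \<in> topspace X \<Longrightarrow> bumps (r x) = bumps x"
    using aS[unfolded aS_def, rule_format, OF continuous_bumps] by blast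
  then have r: "continuous_map X X r" and rZ: "\<And>x. x \<in> topspace X \<Longrightarrow> r x \<in> Z"
    by (auto simp: continuous_map_in_subtopology)
  \<comment> \<open>\<open>Z\<close> contains the image of \<open>r\<close>, \<open>K\<close> puts
    the first chart inside the second, and the seam is what \<open>extend\<close> requires.\<close>
  let ?Q = "Z \<union> (K \<union> (L \<inter> D))"
  have "?Q \<subseteq> topspace X"
    using Z(1) K(3) L_subset by blast
  moreover have "Lindelof_space (subtopology X ?Q)"
    by (intro Lindelof_space_Un Z(2) compactin_imp_Lindelof_space K(2) compact_seam)
  ultimately obtain Y e1 g1 where Y: "?Q \<inter> L \<subseteq> Y" and chart1: "annular_chart (subtopology X L) Y e1 g1"
    using exhaust[of ?Q] by metis
  interpret Y: capped_pipe_chart X L D q Y e1 g1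
    by (intro capped_pipe_chart.intro capped_pipe_axioms capped_pipe_chart_axioms.intro chart1)
  have EY: "E \<subseteq> Y"
    using Y K(1,3) by blast
  have g1: "continuous_map (subtopology X Y) euclidean g1" "0 \<notin> g1 ` Y"
    using Y.continuous_g Y.chartD(6) by (auto simp: continuous_map_in_subtopology ann_def)
  then obtain k where k: "continuous_map (subtopology X (Y \<union> D)) euclidean k"
    "\<And>x. x \<in> Y \<Longrightarrow> k x = g1 x" "\<And>x. x \<in> D \<Longrightarrow> k x = 0 \<Longrightarrow> q x = 1"
    using extend[of Y g1] Y Y.E_L by blast
  define \<phi> where "\<phi> = k \<circ> r"
  have "Z \<subseteq> Y \<union> D"
    using Y Z(1) cover by blast
  then have "continuous_map X (subtopology X (Y \<union> D)) r"
    using r rZ by (auto simp: continuous_map_in_subtopology)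
  then have \<phi>: "continuous_map X euclidean \<phi>"
    unfolding \<phi>_def using k(1) continuous_map_compose by blast
  \<comment> \<open>A zero of \<open>\<phi>\<close> at a point of \<open>L\<close> would mean that
    \<open>r\<close> sends it to the bottom of the well, at height -10, whereas \<open>bumps\<close>
    is at least -3 on \<open>L\<close>.\<close>
  have \<phi>0: "\<phi> x \<noteq> 0" if x: "x \<in> L" for x
  proof
    assume 0: "\<phi> x = 0"
    have "r x \<in> Y \<union> D"
      using rZ x L_subset \<open>Z \<subseteq> Y \<union> D\<close> by blast
    moreover have "r x \<notin> Y"
      using 0 k(2) g1(2) by (force simp: \<phi>_def)
    ultimately have q1: "q (r x) = 1"
      using k(3) 0 by (auto simp: \<phi>_def)
    then have "r x \<notin> E"
      using q(2) E_L by force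
    then have "bumps (r x) = -10"
      using q1 by (simp add: bumps_def)
    moreover have "bumps x \<ge> -3"
      using q(2)[OF x] abs_cones_le[of "g x"] by (auto simp: bumps_def)
    moreover have "bumps (r x) = bumps x"
      using fr x L_subset by blast
    ultimately show False by simp
  qed
  \<comment> \<open>\<open>EC\<close> concerns real functions, so it is applied to both coordinates
    of \<open>\<phi>\<close>.\<close>
  obtain Q1 Q2 c1 c2 where Q: "Q1 \<subseteq> topspace X" "Q2 \<subseteq> topspace X"
    "Lindelof_space (subtopology X Q1)" "Lindelof_space (subtopology X Q2)"
    and c: "(Re \<circ> \<phi>) ` (topspace X - Q1) = {c1}" "(Im \<circ> \<phi>) ` (topspace X - Q2) = {c2}"
  proof -
    have "continuous_map X euclideanreal (Re \<circ> \<phi>)" "continuous_map X euclideanreal (Im \<circ> \<phi>)"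
      by (rule continuous_map_compose[OF \<phi>],
          simp add: continuous_on_Re[OF continuous_on_id, simplified] continuous_on_Im[OF continuous_on_id, simplified])+
    then show thesis
      using EC[unfolded EC_def, rule_format] that by metis
  qed
  let ?Q = "(Q1 \<union> Q2) \<union> K"
  have "?Q \<subseteq> topspace X"
    using Q K(3) L_subset by blast
  moreover have "Lindelof_space (subtopology X ?Q)"
    by (intro Lindelof_space_Un Q compactin_imp_Lindelof_space K(2))
  ultimately obtain E2 K2 where E2: "?Q \<inter> L \<subseteq> E2" and K2: "E2 \<subseteq> K2" "compactin X K2" "K2 \<subseteq> L"
    using exhaust[of ?Q] by metis
  \<comment> \<open>The compact \<open>K2\<close> encloses the part of \<open>Q1 \<union> Q2\<close>
    on \<open>L\<close>. In a chart around it, \<open>K2\<close> stays below some radius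
    \<open>t < 4\<close>, and the circle of radius \<open>t\<close> lies where \<open>\<phi>\<close>
    is constant.\<close>
  obtain E3 e3 g3 where E3: "K2 \<subseteq> E3" and chart3: "annular_chart (subtopology X L) E3 e3 g3"
    using exhaust[of K2] compactin_imp_Lindelof_space[OF K2(2)] K2(3) L_subset
    by (metis inf.absorb1 subset_trans)
  interpret E3: capped_pipe_chart X L D q E3 e3 g3
    by (intro capped_pipe_chart.intro capped_pipe_axioms capped_pipe_chart_axioms.intro chart3)
  have EE3: "E \<subseteq> E3"
    using K(1,3) E2 K2(1) E3 by blast
  obtain t where t: "1/2 \<le> t" "t < 4" "\<And>x. x \<in> K2 \<Longrightarrow> norm (g3 x) < t"
  proof -
    have "compactin (subtopology X E3) K2"
      using K2(2) E3 by (simp add: compactin_subtopology)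
    then have "compactin (top_of_set ann) (g3 ` K2)"
      using image_compactin[OF _ E3.continuous_g] by blast
    then have "compact (g3 ` K2)" "g3 ` K2 \<subseteq> ann"
      by (auto simp: compactin_subtopology)
    then have c: "compact (norm ` g3 ` K2)"
      using compact_continuous_image continuous_on_norm_id by blast
    show thesis
    proof (cases "K2 = {}")
      case True
      then show ?thesis using that[of 1] by auto
    next
      case False
      then obtain s where s: "s \<in> norm ` g3 ` K2" "\<And>u. u \<in> norm ` g3 ` K2 \<Longrightarrow> u \<le> s"
        using compact_attains_sup[OF c] by auto
      then have "1/2 \<le> s" "s < 4"
        using \<open>g3 ` K2 \<subseteq> ann\<close> by (auto simp: ann_def)
      then show ?thesis
        using that[of "(s + 4) / 2"] s(2) by force
    qed
  qed
  have far: "\<phi> (e3 w) = Complex c1 c2" if w: "w \<in> ann" "norm w = t" for w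
  proof -
    have "e3 w \<in> E3"
      using w E3.chartD(4) by blast
    then have "e3 w \<in> L" "e3 w \<in> topspace X"
      using E3.E_L L_subset by auto
    moreover have "e3 w \<notin> K2"
      using t(3)[of "e3 w"] E3.chartD(7)[OF w(1)] w(2) by auto
    ultimately have "e3 w \<in> topspace X - Q1" "e3 w \<in> topspace X - Q2"
      using E2 K2(1) by auto
    then have "(Re \<circ> \<phi>) (e3 w) = c1" "(Im \<circ> \<phi>) (e3 w) = c2"
      using c by blast+
    then show ?thesis
      by (simp add: complex_eq_iff)
  qed
  let ?J = "sphere (0::complex) (sqrt 3)"
  have s3: "1/2 \<le> sqrt 3" "sqrt 3 < 4"
    using real_le_rsqrt[of "1/2" 3] real_less_lsqrt[of 4 3] by (simp_all add: power2_eq_square)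
  then have J: "?J \<subseteq> ann"
    by (auto simp: ann_def)
  have eX: "e z \<in> topspace X" "e z \<in> L" "e z \<in> E" if "z \<in> ann" for z
    using chartD(4) E_L L_subset that by auto
  \<comment> \<open>In the third chart the loop is pushed radially out to the circle of radius
    \<open>t\<close>; \<open>\<phi>\<close> has no zero on the way.\<close>
  have homR: "homotopic_with_canon (\<lambda>_. True) ?J (-{0}) (\<phi> \<circ> e) (\<lambda>_. Complex c1 c2)"
  proof (rule homotopic_through_map)
    let ?p = "\<lambda>z. g3 (e z)"
    have "continuous_map (top_of_set ann) (subtopology X E3) e"
      using continuous_e eX(3) EE3 by (auto simp: continuous_map_in_subtopology)
    then have "continuous_map (top_of_set ann) (top_of_set ann) (g3 \<circ> e)"
      using E3.continuous_g continuous_map_compose by blast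
    then have p: "continuous_on ?J ?p" "\<And>z. z \<in> ?J \<Longrightarrow> ?p z \<in> ann"
      using J by (auto simp: continuous_map_in_subtopology o_def intro: continuous_on_subset)
    then have p0: "norm (?p z) > 0" if "z \<in> ?J" for z
      using that by (fastforce simp: ann_def)
    show "homotopic_with_canon (\<lambda>_. True) ?J ann ?p (\<lambda>z. (t / norm (?p z)) *\<^sub>R ?p z)"
    proof (rule homotopic_with_linear)
      show "continuous_on ?J (\<lambda>z. (t / norm (?p z)) *\<^sub>R ?p z)"
        using p(1) p0 by (intro continuous_intros) auto
      show "closed_segment (?p z) ((t / norm (?p z)) *\<^sub>R ?p z) \<subseteq> ann" if "z \<in> ?J" for z
        using p(2)[OF that] p0[OF that] t(1,2)
        by (intro closed_segment_scaleR_ann) (auto simp: ann_def)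
    qed (rule p(1))
    show "continuous_on ann (\<phi> \<circ> e3)"
      using continuous_map_compose[OF E3.continuous_e \<phi>] by simp
    show "(\<phi> \<circ> e3) z \<noteq> 0" if "z \<in> ann" for z
      using \<phi>0 E3.chartD(4) E3.E_L that by (auto simp: o_def)
    show "(\<phi> \<circ> e) z = (\<phi> \<circ> e3) (?p z)" if "z \<in> ?J" for z
    proof -
      have "e z \<in> E3"
        using eX(3) EE3 J that by blast
      then show ?thesis
        using E3.chartD(8) by simp
    qed
    show "Complex c1 c2 = (\<phi> \<circ> e3) ((t / norm (?p z)) *\<^sub>R ?p z)" if "z \<in> ?J" for z
    proof -
      have "norm ((t / norm (?p z)) *\<^sub>R ?p z) = t"
        using p0[OF that] t(1) by simp
      then show ?thesis
        using far[of "(t / norm (?p z)) *\<^sub>R ?p z"] t(1,2) by (simp add: ann_def)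
    qed
  qed
  have ke: "continuous_on ann (g1 \<circ> e)" "\<And>z. z \<in> ann \<Longrightarrow> (g1 \<circ> e) z \<noteq> 0"
  proof -
    have "continuous_map (top_of_set ann) (subtopology X Y) e"
      using continuous_e eX(3) EY by (auto simp: continuous_map_in_subtopology)
    then show "continuous_on ann (g1 \<circ> e)"
      using g1(1) continuous_map_compose by force
    show "(g1 \<circ> e) z \<noteq> 0" if "z \<in> ann" for z
      using g1(2) eX(3)[OF that] EY by force
  qed
  have re: "\<exists>i<6. z \<in> cball (centre i) 1 \<and> r (e z) \<in> e ` cball (centre i) 1" if "z \<in> ?J" for z
  proof -
    have "norm z = sqrt 3"
      using that by simp
    then obtain i where i: "i < 6" "z \<in> cball (centre i) 1"
      by (rule sphere_subset_cballs)
    then have "r (e z) \<in> e ` cball (centre i) 1"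
      using retraction_preserves_closed_cell[OF r fr i(1)] by blast
    then show ?thesis
      using i by blast
  qed
  have reE: "r (e z) \<in> E" if "z \<in> ?J" for z
    using re[OF that] ball_centre_ann chartD(4) by blast
  \<comment> \<open>Both \<open>z\<close> and \<open>g (r (e z))\<close> lie in one disc, which is
    convex, so the segment between them stays in \<open>ann\<close>.\<close>
  have homI: "homotopic_with_canon (\<lambda>_. True) ?J (-{0}) (g1 \<circ> e) (\<phi> \<circ> e)"
  proof (rule homotopic_through_map[where h = "g1 \<circ> e"])
    show "homotopic_with_canon (\<lambda>_. True) ?J ann (\<lambda>z. z) (\<lambda>z. g (r (e z)))"
    proof (rule homotopic_with_linear)
      have "continuous_map (top_of_set ?J) X (r \<circ> e)"
        using continuous_map_from_subtopology_mono[OF continuous_map_compose[OF continuous_e r] J] .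
      then have "continuous_map (top_of_set ?J) (subtopology X E) (r \<circ> e)"
        using reE by (auto simp: continuous_map_in_subtopology)
      then have "continuous_map (top_of_set ?J) (top_of_set ann) (g \<circ> (r \<circ> e))"
        using continuous_g continuous_map_compose by blast
      then show "continuous_on ?J (\<lambda>z. g (r (e z)))"
        by (simp add: continuous_map_in_subtopology o_def)
      fix z assume "z \<in> ?J"
      then obtain i u where i: "i < 6" "z \<in> cball (centre i) 1" "u \<in> cball (centre i) 1" "r (e z) = e u"
        using re by blast
      then have "g (r (e z)) = u"
        using chartD(7)[of u] ball_centre_ann[OF i(1)] by auto
      then show "closed_segment z (g (r (e z))) \<subseteq> ann"
        using i closed_segment_subset[OF i(2,3) convex_cball] ball_centre_ann[OF i(1)] by auto
    qed simp
    show "(\<phi> \<circ> e) z = (g1 \<circ> e) (g (r (e z)))" if "z \<in> ?J" for z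
      using chartD(8)[OF reE[OF that]] k(2)[of "r (e z)"] reE[OF that] EY by (auto simp: \<phi>_def)
  qed (use ke in simp_all)
  \<comment> \<open>The factor shrinks radius \<open>sqrt 3\<close> to 1/2, so
    \<open>e \<circ> h\<close> runs along the inner edge of the first chart, which \<open>g1\<close>
    takes injectively into the inner circle of the second.\<close>
  define h where "h z = (1 / (2 * sqrt 3)) *\<^sub>R z" for z :: complex
  have h: "norm (h z) = 1/2" "h z \<in> ann" if "z \<in> ?J" for z
    using that by (auto simp: h_def ann_def)
  have homS: "homotopic_with_canon (\<lambda>_. True) ?J (-{0}) (g1 \<circ> e) (g1 \<circ> e \<circ> h)"
  proof (rule homotopic_through_map[where h = "g1 \<circ> e"])
    show "homotopic_with_canon (\<lambda>_. True) ?J ann (\<lambda>z. z) h"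
    proof (rule homotopic_with_linear)
      show "closed_segment z (h z) \<subseteq> ann" if "z \<in> ?J" for z
        using h(2)[OF that] J that unfolding h_def by (intro closed_segment_scaleR_ann) auto
    qed (auto simp: h_def intro!: continuous_intros)
  qed (use ke in simp_all)
  have "homotopic_with_canon (\<lambda>_. True) ?J (-{0}) (g1 \<circ> e \<circ> h) (\<lambda>_. Complex c1 c2)"
    using homotopic_with_symD[OF homS] homI homR homotopic_with_trans by blast
  moreover have "inj_on (g1 \<circ> e \<circ> h) ?J"
  proof (rule inj_onI)
    fix z z' assume z: "z \<in> ?J" "z' \<in> ?J" "(g1 \<circ> e \<circ> h) z = (g1 \<circ> e \<circ> h) z'"
    then have "e1 (g1 (e (h z))) = e1 (g1 (e (h z')))" by simp
    then have "e (h z) = e (h z')"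
      using Y.chartD(8) eX(3) h(2) z(1,2) EY by (metis subsetD)
    then have "h z = h z'"
      using inj_e h(2) z(1,2) by (metis inj_onD)
    then show "z = z'"
      by (simp add: h_def)
  qed
  moreover have "norm ((g1 \<circ> e \<circ> h) z) = 1/2" if "z \<in> ?J" for z
    using annular_chart_inner_boundary[OF chart chart1 EY h(2,1)] that by simp
  ultimately show False
    using injective_circle_not_nullhomotopic[of "sqrt 3" "1/2" "g1 \<circ> e \<circ> h"] by simp
qed

end

section \<open>Longpipes and sealed longpipes as capped pipes\<close>

text \<open>Only the origin needs care: \<open>W\<close> is bounded on the compact sphere, so the
  factor \<open>norm v\<close> forces the limit 0, which is also the value there.\<close>

lemma continuous_on_radial_extension:
  fixes W :: "'b::euclidean_space \<Rightarrow> 'c::real_normed_vector"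
  assumes "continuous_on (sphere 0 1) W"
  shows "continuous_on (cball 0 1) (\<lambda>v. norm v *\<^sub>R W (v /\<^sub>R norm v))"
  unfolding continuous_on_eq_continuous_within
proof
  fix v :: 'b
  show "continuous (at v within cball 0 1) (\<lambda>v. norm v *\<^sub>R W (v /\<^sub>R norm v))"
  proof (cases "v = 0")
    case True
    have "bounded (W ` sphere 0 1)"
      by (rule compact_imp_bounded[OF compact_continuous_image[OF assms compact_sphere]])
    then obtain b where b: "\<And>u. u \<in> sphere 0 1 \<Longrightarrow> norm (W u) \<le> b"
      unfolding bounded_iff by blast
    have le: "norm (norm u *\<^sub>R W (u /\<^sub>R norm u)) \<le> norm u * b" for u
      using b[of "u /\<^sub>R norm u"] by (cases "u = 0") (auto intro: mult_left_mono)
    have "((\<lambda>u::'b. norm u * b) \<longlongrightarrow> 0) (at 0 within cball 0 1)"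
      by (auto intro!: tendsto_eq_intros)
    then have "((\<lambda>u. norm u *\<^sub>R W (u /\<^sub>R norm u)) \<longlongrightarrow> 0) (at 0 within cball 0 1)"
      by (rule Lim_null_comparison[OF always_eventually[OF allI[OF le]]])
    then show ?thesis
      using True by (simp add: continuous_within)
  next
    case False
    have "continuous_on (- {0}) (\<lambda>v. norm v *\<^sub>R W (v /\<^sub>R norm v))"
      by (intro continuous_intros continuous_on_compose2[OF assms]) (auto, metis left_inverse norm_eq_zero)
    then have "isCont (\<lambda>v. norm v *\<^sub>R W (v /\<^sub>R norm v)) v"
      using False by (auto simp: continuous_on_eq_continuous_at open_Compl)
    then show ?thesis
      by (rule continuous_at_imp_continuous_within)
  qed
qed

text \<open>With an empty cap the conditions on \<open>D\<close> are vacuous, and \<open>w\<close>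
  is its own extension.\<close>

lemma longpipe_capped_pipe:
  assumes "longpipe X"
  shows "capped_pipe X (topspace X) {} (\<lambda>_. 0)"
proof
  show "Hausdorff_space X"
    using assms by (simp add: longpipe_def)
  show "annularly_exhausted (subtopology X (topspace X))"
    using longpipe_annularly_exhausted[OF assms] by simp
qed auto

lemma sealed_longpipe_capped_pipe:
  assumes "sealed_longpipe X"
  obtains L D q where "capped_pipe X L D q"
proof -
  obtain L D h where X: "Hausdorff_space X" "closedin X L" "closedin X D" "L \<union> D = topspace X"
    and L: "longpipe (subtopology X L)" and LD: "L \<inter> D = manifold_boundary (subtopology X L)"
    and h: "homeomorphic_map (subtopology X D) (top_of_set (cball (0::real \<times> real) 1)) h"
    and hLD: "h ` (L \<inter> D) = sphere 0 1"
    using assms by (auto simp: sealed_longpipe_def)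
  have DX: "topspace (subtopology X D) = D"
    using closedin_subset[OF X(3)] by (simp add: Int_absorb1)
  obtain h' where h': "homeomorphic_maps (subtopology X D) (top_of_set (cball (0::real \<times> real) 1)) h h'"
    using h homeomorphic_map_maps by blast
  have ch: "continuous_map (subtopology X D) (top_of_set (cball 0 1)) h"
    and ch': "continuous_map (top_of_set (cball 0 1)) (subtopology X D) h'"
    and h'h: "\<And>x. x \<in> D \<Longrightarrow> h' (h x) = x"
    using h' DX by (auto simp: homeomorphic_maps_def)
  have hD: "norm (h x) \<le> 1" if "x \<in> D" for x
    using ch that DX by (fastforce simp: continuous_map_def)
  have h_seam: "norm (h x) = 1" if "x \<in> L" "x \<in> D" for x
    using hLD that by (force simp: image_iff)
  have h'_seam: "h' v \<in> L \<inter> D" if v: "v \<in> sphere 0 1" for v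
  proof -
    obtain x where "x \<in> L \<inter> D" "v = h x"
      using hLD v by blast
    then show ?thesis
      using h'h by simp
  qed
  \<comment> \<open>The seam has radius 1 in the disc coordinates, so the two formulas agree on
    \<open>L \<inter> D\<close>.\<close>
  define q where "q x = (if x \<in> D then 1 - norm (h x) else 0)" for x
  have q_L: "q x = 0" if "x \<in> L" for x
    using h_seam that by (simp add: q_def)
  have "capped_pipe X L D q"
  proof
    fix E e g z
    assume c: "annular_chart (subtopology X L) E e g" "z \<in> ann" "1/2 < norm z"
    \<comment> \<open>The seam is the manifold boundary of \<open>L\<close>, which a chart meets at
      most along its inner circle.\<close>
    have "e z \<in> L"
      using annular_chartD(2,4)[OF c(1)] c(2) by auto
    then show "e z \<notin> D"
      using annular_chart_interior_not_boundary[OF c] LD by blast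
  next
    have "subtopology (subtopology X L) (L \<inter> D) homeomorphic_space circle"
      using L LD by (simp add: longpipe_def)
    then have "compact_space (subtopology X (L \<inter> D))"
      using homeomorphic_compact_space[of _ circle] compact_sphere
      by (simp add: circle_def subtopology_subtopology compact_space_subtopology)
    then show "compactin X (L \<inter> D)"
      using X(4) by (auto simp: compactin_subspace)
  next
    show "continuous_map X euclideanreal q"
    proof (rule pasting_lemma_closed[where I = UNIV and T = "\<lambda>b. if b then D else L"
          and f = "\<lambda>b x. if b then 1 - norm (h x) else 0"])
      fix b :: bool
      have "continuous_map (subtopology X D) euclideanreal (\<lambda>x. 1 - norm (h x))"
        using ch by (intro continuous_intros) (simp add: continuous_map_in_subtopology)
      then show "continuous_map (subtopology X (if b then D else L)) euclideanreal (\<lambda>x. if b then 1 - norm (h x) else 0)"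
        by (cases b) auto
    next
      fix x assume "x \<in> topspace X"
      then show "\<exists>b. b \<in> UNIV \<and> x \<in> (if b then D else L) \<and> q x = (if b then 1 - norm (h x) else 0)"
        using X(4) by (intro exI[of _ "x \<in> D"]) (auto simp: q_def)
    qed (use X h_seam in \<open>auto split: if_splits\<close>)
    show "q x = 0" if "x \<in> L" for x
      using q_L that .
    show "0 < q x \<and> q x \<le> 1" if x: "x \<in> D - L" for x
    proof -
      have "norm (h x) \<noteq> 1"
      proof
        assume "norm (h x) = 1"
        then have "h' (h x) \<in> L"
          using h'_seam by simp
        then show False
          using h'h x by simp
      qed
      then show ?thesis
        using hD[of x] x by (simp add: q_def)
    qed
  next
    fix Y and w :: "'a \<Rightarrow> complex"
    assume Y: "L \<inter> D \<subseteq> Y" "Y \<subseteq> L" and w: "continuous_map (subtopology X Y) euclidean w" "0 \<notin> w ` Y"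
    define W where "W = w \<circ> h'"
    \<comment> \<open>Since \<open>w\<close> has no zeros on the seam, this extension vanishes at
      the disc centre only, where \<open>q\<close> is 1.\<close>
    define rad where "rad v = norm v *\<^sub>R W (v /\<^sub>R norm v)" for v
    define k where "k x = (if x \<in> D then rad (h x) else w x)" for x
    have "continuous_map (top_of_set (sphere 0 1)) X h'"
      using ch' by (auto simp: continuous_map_in_subtopology intro: continuous_map_from_subtopology_mono)
    then have "continuous_map (top_of_set (sphere 0 1)) (subtopology X Y) h'"
      using h'_seam Y(1) by (auto simp: continuous_map_in_subtopology)
    then have "continuous_map (top_of_set (sphere 0 1)) euclidean W"
      unfolding W_def using continuous_map_compose[OF _ w(1)] by blast
    then have "continuous_on (sphere 0 1) W"
      by simp
    then have "continuous_on (cball 0 1) rad"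
      unfolding rad_def by (rule continuous_on_radial_extension)
    then have kD: "continuous_map (subtopology X D) euclidean (rad \<circ> h)"
      using continuous_map_compose[OF ch, of euclidean rad] by simp
    have seam: "rad (h x) = w x" if "x \<in> Y" "x \<in> D" for x
      using h_seam[of x] h'h[of x] that Y(2) by (auto simp: rad_def W_def)
    have "continuous_map (subtopology X (Y \<union> D)) euclidean k"
    proof (rule pasting_lemma_closed[where I = UNIV and T = "\<lambda>b. if b then D else Y"
          and f = "\<lambda>b. if b then rad \<circ> h else w"])
      fix b :: bool
      \<comment> \<open>Because \<open>Y\<close> contains the seam, it is the trace of the closed
        set \<open>L\<close> and so closed in \<open>Y \<union> D\<close>, even if not in
        \<open>X\<close>.\<close>
      have "(Y \<union> D) \<inter> L = Y"
        using Y by blast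
      then have "closedin (subtopology X (Y \<union> D)) Y"
        using X(2) closedin_subtopology_Int_closed by metis
      moreover have "closedin (subtopology X (Y \<union> D)) D"
        using X(3) by (simp add: closedin_closed_subtopology closedin_subset_topspace)
      ultimately show "closedin (subtopology X (Y \<union> D)) (if b then D else Y)"
        by simp
      show "continuous_map (subtopology (subtopology X (Y \<union> D)) (if b then D else Y)) euclidean (if b then rad \<circ> h else w)"
        using kD w(1) by (simp add: subtopology_subtopology Int_absorb1)
    next
      fix x assume "x \<in> topspace (subtopology X (Y \<union> D))"
      then show "\<exists>b. b \<in> UNIV \<and> x \<in> (if b then D else Y) \<and> k x = (if b then rad \<circ> h else w) x"
        by (intro exI[of _ "x \<in> D"]) (auto simp: k_def)
    qed (use seam in \<open>auto split: if_splits\<close>)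
    moreover have "k x = w x" if "x \<in> Y" for x
      using seam that by (simp add: k_def)
    moreover have "q x = 1" if x: "x \<in> D" "k x = 0" for x
    proof -
      have "h x = 0"
      proof (rule ccontr)
        assume "h x \<noteq> 0"
        then have 0: "w (h' (h x /\<^sub>R norm (h x))) = 0" and "h x /\<^sub>R norm (h x) \<in> sphere 0 1"
          using x by (auto simp: k_def rad_def W_def)
        then have "h' (h x /\<^sub>R norm (h x)) \<in> Y"
          using h'_seam Y(1) by blast
        then show False
          using 0 w(2) by (metis image_eqI)
      qed
      then show ?thesis
        using x(1) by (simp add: q_def)
    qed
    ultimately show "\<exists>k. continuous_map (subtopology X (Y \<union> D)) euclidean k \<and> (\<forall>x\<in>Y. k x = w x) \<and>
        (\<forall>x\<in>D. k x = 0 \<longrightarrow> q x = 1)"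
      by blast
  qed (use X longpipe_annularly_exhausted[OF L] in auto)
  then show thesis using that by blast
qed

theorem theorem7p6:
  fixes X :: "'a topology"
  assumes "longpipe X \<or> sealed_longpipe X"
    and "EC X (euclidean :: real topology)"
  shows "\<not> aS X (euclidean :: real topology)"
proof -
  obtain L D q where "capped_pipe X L D q"
    using assms(1) longpipe_capped_pipe sealed_longpipe_capped_pipe by blast
  then show ?thesis
    using assms(2) by (rule capped_pipe.EC_imp_not_aS)
qed

end
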